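(* Let $G=(V,E)$ be a simple, connected, undirected graph with $n$ nodes, $m$ edges and diameter $\Delta_G$; fix a root $r$, let $\tau_0$ be a breadth-first-search spanning tree of $G$ rooted at $r$, and for each $u\neq r$ let $\mathcal{P}_u$ be the path from $u$ to $r$ in $\tau_0$. Let $\tilde\kappa=\frac{1}{2m\omega}\sum_{i=1}^{\omega}f(\hat\tau_i)$, where $\hat\tau_1,\dots,\hat\tau_\omega$ are independent uniformly random spanning trees of $G$ and $$f(\tau)=\sum_{u\neq r}d(u)\left(\sum_{T_1\cup T_2\in\mathbb{F}^{\mathcal{P}_u}(\tau)}\mathrm{vol}(T_1)-\sum_{T_1\cup T_2\in\mathbb{F}^{\mathcal{P}_u'}(\tau)}\mathrm{vol}(T_1)\right).$$ Let $\varepsilon>0$ and $p_f\in(0,1)$. If $\omega\ge\frac{8m^2\Delta_G^2\log(2/p_f)}{n^2\varepsilon^2}$, then $|\tilde\kappa-\kappa(G)|\le\varepsilon\,\kappa(G)$ with probability at least $1-p_f$.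
   Context: $d(v)$ is the degree of $v$ in $G$ and $\mathrm{vol}(S)=\sum_{v\in S}d(v)$. $\kappa(G)$ is the Kemeny constant: $\kappa(G)=\sum_j\frac{d(j)}{2m}H(i,j)$ with $H(i,j)$ the expected hitting time from $i$ to $j$ of the simple random walk on $G$ (independent of $i$); equivalently the sum of reciprocals of the nonzero eigenvalues of $I-D^{-1/2}AD^{-1/2}$. A 2-forest is a spanning forest with exactly two trees, written $T_1\cup T_2$ with $T_1$ the node set of the tree containing $r$. For a simple directed path $\mathcal{P}$ from $u$ to $r$ and spanning tree $\tau$ with $\mathcal{P}^{(\tau)}_{u\to r}$ the unique $u$-to-$r$ path in $\tau$ (edges directed towards $r$): $\mathbb{F}^{\mathcal{P}}(\tau)=\{\tau\setminus\{i,j\}: (i,j)\in\mathcal{P},\ (i,j)\in\mathcal{P}^{(\tau)}_{u\to r}\}$ and $\mathbb{F}^{\mathcal{P}'}(\tau)=\{\tau\setminus\{i,j\}: (i,j)\in\mathcal{P},\ (j,i)\in\mathcal{P}^{(\tau)}_{u\to r}\}$, membership referring to directed edges along the paths. ($\tilde\kappa$ is exactly the output of the paper's Algorithm 1 with sample size $\omega$.) *)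

theory Defs
  imports "HOL-Probability.Probability" "HOL-Probability.Stream_Space"
    "HOL-Probability.Product_PMF"
begin

section \<open>Simple graphs and trees\<close>

text \<open>The vertex set is the finite type \<open>'a\<close>, so \<open>n = CARD('a)\<close>. A graph, a spanning tree and a
  spanning forest are each given by a set of undirected edges \<open>{i, j}\<close>.\<close>

definition simple_graph :: "'a::finite set set \<Rightarrow> bool" where
  "simple_graph E \<longleftrightarrow> (\<forall>e\<in>E. card e = 2)"

definition neighbors :: "'a::finite set set \<Rightarrow> 'a \<Rightarrow> 'a set" where
  "neighbors E v = {w. {v, w} \<in> E}"

definition vdegree :: "'a::finite set set \<Rightarrow> 'a \<Rightarrow> nat" where
  "vdegree E v = card (neighbors E v)"

definition vol :: "'a::finite set set \<Rightarrow> 'a set \<Rightarrow> nat" where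
  "vol E S = (\<Sum>v\<in>S. vdegree E v)"

definition gwalk :: "'a::finite set set \<Rightarrow> 'a \<Rightarrow> 'a list \<Rightarrow> 'a \<Rightarrow> bool" where
  "gwalk E u p v \<longleftrightarrow> p \<noteq> [] \<and> hd p = u \<and> last p = v \<and> successively (\<lambda>x y. {x, y} \<in> E) p"

definition gpath :: "'a::finite set set \<Rightarrow> 'a \<Rightarrow> 'a list \<Rightarrow> 'a \<Rightarrow> bool" where
  "gpath E u p v \<longleftrightarrow> gwalk E u p v \<and> distinct p"

definition path_arcs :: "'a list \<Rightarrow> ('a \<times> 'a) set" where
  "path_arcs p = set (zip p (tl p))"

definition connected_graph :: "'a::finite set set \<Rightarrow> bool" where
  "connected_graph E \<longleftrightarrow> (\<forall>u v. \<exists>p. gwalk E u p v)"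

definition gcycle :: "'a::finite set set \<Rightarrow> 'a list \<Rightarrow> bool" where
  "gcycle E c \<longleftrightarrow> length c \<ge> 3 \<and> distinct c \<and> successively (\<lambda>x y. {x, y} \<in> E) c \<and> {last c, hd c} \<in> E"

definition acyclic_graph :: "'a::finite set set \<Rightarrow> bool" where
  "acyclic_graph E \<longleftrightarrow> (\<nexists>c. gcycle E c)"

definition spanning_trees :: "'a::finite set set \<Rightarrow> 'a set set set" where
  "spanning_trees E = {\<tau>. \<tau> \<subseteq> E \<and> connected_graph \<tau> \<and> acyclic_graph \<tau>}"

definition tree_path :: "'a::finite set set \<Rightarrow> 'a \<Rightarrow> 'a \<Rightarrow> 'a list" where
  "tree_path \<tau> u r = (THE p. gpath \<tau> u p r)"

definition graph_dist :: "'a::finite set set \<Rightarrow> 'a \<Rightarrow> 'a \<Rightarrow> nat" where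
  "graph_dist E u v = (LEAST k. \<exists>p. gwalk E u p v \<and> length p = Suc k)"

definition graph_diameter :: "'a::finite set set \<Rightarrow> nat" where
  "graph_diameter E = Max {graph_dist E u v | u v. True}"

text \<open>\<open>bfs_run E r Q D \<tau>\<close>: a run of breadth-first search from \<open>r\<close>, scanning neighbours in an arbitrary
  order, can reach the state with queue \<open>Q\<close>, discovered vertices \<open>D\<close> and tree edges \<open>\<tau>\<close>.\<close>

inductive bfs_run :: "'a::finite set set \<Rightarrow> 'a \<Rightarrow> 'a list \<Rightarrow> 'a set \<Rightarrow> 'a set set \<Rightarrow> bool"
  for E r where
  start: "bfs_run E r [r] {r} {}"
| discover: "bfs_run E r (u # Q) D \<tau> \<Longrightarrow> v \<in> neighbors E u \<Longrightarrow> v \<notin> D \<Longrightarrow>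
    bfs_run E r (u # Q @ [v]) (insert v D) (insert {u, v} \<tau>)"
| dequeue: "bfs_run E r (u # Q) D \<tau> \<Longrightarrow> neighbors E u \<subseteq> D \<Longrightarrow> bfs_run E r Q D \<tau>"

definition bfs_spanning_tree :: "'a::finite set set \<Rightarrow> 'a \<Rightarrow> 'a set set \<Rightarrow> bool" where
  "bfs_spanning_tree E r \<tau> \<longleftrightarrow> \<tau> \<in> spanning_trees E \<and> (\<exists>D. bfs_run E r [] D \<tau>)"


section \<open>Simple random walk, hitting times and the Kemeny constant\<close>

text \<open>The walk is driven by an i.i.d. sequence of random maps \<open>\<phi>\<^sub>0, \<phi>\<^sub>1, \<dots>\<close>: the values
  \<open>\<phi>\<^sub>t v\<close>, for all \<open>t\<close> and \<open>v\<close>, are independent, \<open>\<phi>\<^sub>t v\<close> is uniform on the neighbours of \<open>v\<close>, and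
  \<open>X\<^sub>t\<^sub>+\<^sub>1 = \<phi>\<^sub>t X\<^sub>t\<close>. The lemma \<open>random_walk_law\<close> confirms that this is the simple random walk.\<close>

definition random_map_pmf :: "'a::finite set set \<Rightarrow> ('a \<Rightarrow> 'a) pmf" where
  "random_map_pmf E = Pi_pmf UNIV undefined (\<lambda>v. pmf_of_set (neighbors E v))"

definition random_maps :: "'a::finite set set \<Rightarrow> ('a \<Rightarrow> 'a) stream measure" where
  "random_maps E = stream_space (measure_pmf (random_map_pmf E))"

primrec random_walk :: "'a \<Rightarrow> ('a \<Rightarrow> 'a) stream \<Rightarrow> nat \<Rightarrow> 'a" where
  "random_walk i \<omega> 0 = i"
| "random_walk i \<omega> (Suc t) = (\<omega> !! t) (random_walk i \<omega> t)"

text \<open>The hitting time is \<open>\<infinity>\<close> if the vertex is never visited, and \<open>0\<close> if it is the initial vertex.\<close>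

definition hitting_time :: "(nat \<Rightarrow> 'a) \<Rightarrow> 'a \<Rightarrow> enat" where
  "hitting_time X j = Inf {enat t | t. X t = j}"

definition expected_hitting_time :: "'a::finite set set \<Rightarrow> 'a \<Rightarrow> 'a \<Rightarrow> ennreal" where
  "expected_hitting_time E i j =
     (\<integral>\<^sup>+\<omega>. ennreal_of_enat (hitting_time (random_walk i \<omega>) j) \<partial>random_maps E)"

text \<open>The description operator picks the common value over all starting vertices \<open>i\<close>. For a connected
  graph the expected hitting times are finite, so \<open>enn2real\<close> loses nothing.\<close>

definition kemeny_constant :: "'a::finite set set \<Rightarrow> real" where
  "kemeny_constant E = (THE k. \<forall>i. k =
     (\<Sum>j\<in>UNIV. real (vdegree E j) / (2 * real (card E)) * enn2real (expected_hitting_time E i j)))"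

lemma random_walk_SCons:
  "random_walk i (\<phi> ## \<omega>) (Suc t) = random_walk (\<phi> i) \<omega> t"
  by (induction t) simp_all

lemma sets_random_maps [measurable_cong]:
  "sets (random_maps E) = sets (stream_space (count_space UNIV))"
  unfolding random_maps_def by (rule sets_stream_space_cong) simp

lemma measurable_random_walk [measurable]:
  "(\<lambda>\<omega>. random_walk (i :: 'a::finite) \<omega> t) \<in> random_maps E \<rightarrow>\<^sub>M count_space UNIV"
proof (induction t)
  case (Suc t)
  note Suc [measurable]
  have sh [measurable]: "(\<lambda>\<omega>. \<omega> !! t) \<in> random_maps E \<rightarrow>\<^sub>M count_space UNIV"
    by measurable
  have "(\<lambda>\<omega>. (\<omega> !! t) (random_walk i \<omega> t)) \<in> random_maps E \<rightarrow>\<^sub>M count_space UNIV"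
    by (rule measurable_compose_countable[where g = "\<lambda>\<omega>. random_walk i \<omega> t"])
       (use measurable_compose[OF sh, of "\<lambda>f. f _"] in simp_all)
  then show ?case by simp
qed simp

lemma random_walk_law:
  fixes E :: "'a::finite set set"
  assumes ne: "\<And>v. neighbors E v \<noteq> {}"
  shows "measure (random_maps E) {\<omega> \<in> space (random_maps E). \<forall>s\<le>t. random_walk i \<omega> s = x s} =
    (if x 0 = i
     then \<Prod>s<t. if x (Suc s) \<in> neighbors E (x s) then 1 / real (vdegree E (x s)) else 0
     else 0)"
proof (induction t arbitrary: i x)
  case 0
  interpret prob_space "random_maps E"
    unfolding random_maps_def by (rule prob_space.prob_space_stream_space[OF prob_space_measure_pmf])
  show ?case by (auto simp: prob_space)
next
  case (Suc t)
  let ?K = "measure_pmf (random_map_pmf E)"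
  let ?A = "{\<omega> \<in> space (random_maps E). \<forall>s\<le>Suc t. random_walk i \<omega> s = x s}"
  define c where "c = (if x 0 = i then \<Prod>s<t. if x (Suc (Suc s)) \<in> neighbors E (x (Suc s))
      then 1 / real (vdegree E (x (Suc s))) else 0 else 0)"
  have c0: "c \<ge> 0"
    by (auto simp: c_def intro!: prod_nonneg)
  interpret prob_space "random_maps E"
    unfolding random_maps_def by (rule prob_space.prob_space_stream_space[OF prob_space_measure_pmf])
  have sp: "space (random_maps E) = UNIV"
    by (simp add: random_maps_def space_stream_space)
  have "?A \<in> sets (random_maps E)"
    by measurable
  then have A: "?A \<in> sets (stream_space ?K)"
    by (simp add: random_maps_def)
  have all: "(\<forall>s\<le>Suc t. P s) \<longleftrightarrow> P 0 \<and> (\<forall>s\<le>t. P (Suc s))" for P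
    by (metis Suc_le_mono le0 not0_implies_Suc)
  have "emeasure (random_maps E) ?A =
      (\<integral>\<^sup>+\<phi>. emeasure (random_maps E) {\<omega>\<in>space (random_maps E). \<phi> ## \<omega> \<in> ?A} \<partial>?K)"
    using prob_space.emeasure_stream_space[OF prob_space_measure_pmf A]
    by (simp add: random_maps_def)
  also have "\<dots> = (\<integral>\<^sup>+\<phi>. (if x 0 = i then emeasure (random_maps E)
      {\<omega>\<in>space (random_maps E). \<forall>s\<le>t. random_walk (\<phi> i) \<omega> s = x (Suc s)} else 0) \<partial>?K)"
    by (intro nn_integral_cong)
       (auto simp: sp all random_walk_SCons simp del: random_walk.simps(2))
  also have "\<dots> = (\<integral>\<^sup>+\<phi>. ennreal c * indicator {\<phi>. \<phi> i = x 1} \<phi> \<partial>?K)"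
    by (intro nn_integral_cong) (auto simp: emeasure_eq_measure Suc.IH c_def indicator_def)
  also have "\<dots> = ennreal c * emeasure ?K {\<phi>. \<phi> i = x 1}"
    by (rule nn_integral_cmult_indicator) simp
  also have "emeasure ?K {\<phi>. \<phi> i = x 1} = pmf (map_pmf (\<lambda>\<phi>. \<phi> i) (random_map_pmf E)) (x 1)"
    by (simp add: pmf_map vimage_def measure_pmf.emeasure_eq_measure)
  also have "pmf (map_pmf (\<lambda>\<phi>. \<phi> i) (random_map_pmf E)) (x 1) =
      (if x 1 \<in> neighbors E i then 1 / real (vdegree E i) else 0)"
    using ne by (simp add: random_map_pmf_def Pi_pmf_component vdegree_def indicator_def)
  finally have "measure (random_maps E) ?A =
      c * (if x 1 \<in> neighbors E i then 1 / real (vdegree E i) else 0)"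
    using c0 by (auto simp: emeasure_eq_measure simp flip: ennreal_mult)
  then show ?case
    by (subst prod.lessThan_Suc_shift) (auto simp: c_def)
qed


section \<open>The spanning tree estimator\<close>

text \<open>The node set of the tree containing \<open>r\<close> in the spanning forest \<open>F\<close>.\<close>

definition tree_of :: "'a::finite set set \<Rightarrow> 'a \<Rightarrow> 'a set" where
  "tree_of F r = {v. \<exists>p. gwalk F r p v}"

definition forests_along :: "'a::finite list \<Rightarrow> 'a \<Rightarrow> 'a \<Rightarrow> 'a set set \<Rightarrow> 'a set set set" where
  "forests_along P u r \<tau> =
     {\<tau> - {{i, j}} | i j. (i, j) \<in> path_arcs P \<and> (i, j) \<in> path_arcs (tree_path \<tau> u r)}"

definition forests_against :: "'a::finite list \<Rightarrow> 'a \<Rightarrow> 'a \<Rightarrow> 'a set set \<Rightarrow> 'a set set set" where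
  "forests_against P u r \<tau> =
     {\<tau> - {{i, j}} | i j. (i, j) \<in> path_arcs P \<and> (j, i) \<in> path_arcs (tree_path \<tau> u r)}"

definition tree_stat :: "'a::finite set set \<Rightarrow> 'a \<Rightarrow> 'a set set \<Rightarrow> 'a set set \<Rightarrow> real" where
  "tree_stat E r \<tau>\<^sub>0 \<tau> = (\<Sum>u\<in>UNIV - {r}. real (vdegree E u) *
     ((\<Sum>F\<in>forests_along (tree_path \<tau>\<^sub>0 u r) u r \<tau>. real (vol E (tree_of F r))) -
      (\<Sum>F\<in>forests_against (tree_path \<tau>\<^sub>0 u r) u r \<tau>. real (vol E (tree_of F r)))))"

definition kemeny_estimate ::
  "'a::finite set set \<Rightarrow> 'a \<Rightarrow> 'a set set \<Rightarrow> nat \<Rightarrow> (nat \<Rightarrow> 'a set set) \<Rightarrow> real" where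
  "kemeny_estimate E r \<tau>\<^sub>0 w \<tau> =
     1 / (2 * real (card E) * real w) * (\<Sum>i=1..w. tree_stat E r \<tau>\<^sub>0 (\<tau> i))"

end

theory Submission
  imports Defs
begin

text \<open>
  For a spanning forest with exactly two trees, let \<open>a\<close> and \<open>b\<close> be the volumes of its trees, and let
  \<open>N\<close> be the number of spanning trees. Deleting an arc from the \<open>u\<close>--\<open>v\<close> path of a spanning tree gives
  a two-tree forest that separates \<open>u\<close> from \<open>v\<close>, and adding an edge of \<open>E\<close> between its trees inverts
  this. Telescoping along paths then shows two things. First, \<open>h i = (\<Sum>F separating i, j. volume of the
  tree of i) / N\<close> satisfies the one-step equations of the expected hitting time of \<open>j\<close>, so that
  \<open>2 m N \<kappa> = \<Sum>F. a * b\<close>. Second, the estimator, summed over all spanning trees, has the same value: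
  a path from \<open>u\<close> to \<open>r\<close> crosses from the tree of \<open>u\<close> to the tree of \<open>r\<close> exactly once, net of
  crossings back.

  Hoeffding's inequality would give the stated sample size directly if \<open>\<kappa> \<ge> n\<close>. What holds is
  \<open>\<kappa> \<ge> (n - 1)\<^sup>2 / n\<close>, from the Dirichlet energy of \<open>h\<close> and the Cauchy--Schwarz inequality. The
  missing factor \<open>((n - 1) / n)\<^sup>2\<close> is gained in the range of the statistic, once because a volume
  is at most \<open>2 m - d(u)\<close> and once because at most \<open>\<Delta> - 2\<close> arcs are traversed backwards.
\<close>

subsection \<open>Trees, two-tree forests and the paths in them\<close>

text \<open>Connectivity is used through this relation: the trees of a forest are its classes, and
  \<open>tree_of F u\<close> is the class of \<open>u\<close>.\<close>

definition linked :: "'a::finite set set \<Rightarrow> 'a \<Rightarrow> 'a \<Rightarrow> bool" where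
  "linked F u v \<longleftrightarrow> (\<exists>p. gwalk F u p v)"

lemma gwalk_Cons:
  "gwalk F u (x # p) v \<longleftrightarrow> x = u \<and> (p = [] \<and> u = v \<or> p \<noteq> [] \<and> {u, hd p} \<in> F \<and> gwalk F (hd p) p v)"
  by (auto simp: gwalk_def successively_Cons)

lemma gwalk_append:
  assumes "gwalk F u p v" "gwalk F v q w"
  shows "gwalk F u (p @ tl q) w"
  using assms
proof (induction p arbitrary: u)
  case Nil
  then show ?case by (simp add: gwalk_def)
next
  case (Cons x p)
  show ?case
  proof (cases "p = []")
    case True
    then have "x = v" "u = v" using Cons.prems by (auto simp: gwalk_def)
    moreover have "x # tl q = q"
      using Cons.prems(2) \<open>x = v\<close> by (cases q) (auto simp: gwalk_def)
    ultimately show ?thesis using Cons.prems(2) True by simp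
  next
    case False
    then have "gwalk F (hd p) (p @ tl q) w"
      using Cons by (auto simp: gwalk_Cons)
    then show ?thesis using Cons.prems(1) False by (auto simp: gwalk_Cons)
  qed
qed

lemma gwalk_rev: "gwalk F u p v \<Longrightarrow> gwalk F v (rev p) u"
  by (auto simp: gwalk_def hd_rev last_rev insert_commute)

lemma gwalk_mono: "gwalk F u p v \<Longrightarrow> F \<subseteq> F' \<Longrightarrow> gwalk F' u p v"
  unfolding gwalk_def by (auto elim: successively_mono)

lemma linked_refl [simp]: "linked F u u"
  unfolding linked_def by (rule exI[of _ "[u]"]) (simp add: gwalk_def)

lemma linked_trans: "linked F u v \<Longrightarrow> linked F v w \<Longrightarrow> linked F u w"
  unfolding linked_def using gwalk_append by blast

lemma linked_sym: "linked F u v \<Longrightarrow> linked F v u"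
  unfolding linked_def using gwalk_rev by blast

lemma linked_mono: "linked F u v \<Longrightarrow> F \<subseteq> F' \<Longrightarrow> linked F' u v"
  unfolding linked_def using gwalk_mono by blast

lemma linked_edge: "{u, v} \<in> F \<Longrightarrow> linked F u v"
  unfolding linked_def by (rule exI[of _ "[u, v]"]) (simp add: gwalk_def)

text \<open>Edges are peeled off the start of a walk while its end \<open>v\<close> stays fixed, so
  arguments about components need no lists.\<close>

lemma linked_induct [consumes 1, case_names refl step]:
  assumes "linked F u v" and "P v"
    and step: "\<And>x y. {x, y} \<in> F \<Longrightarrow> linked F y v \<Longrightarrow> P y \<Longrightarrow> P x"
  shows "P u"
proof -
  obtain p where "gwalk F u p v" using assms(1) by (auto simp: linked_def)
  then show ?thesis
  proof (induction p arbitrary: u)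
    case Nil
    then show ?case by (simp add: gwalk_def)
  next
    case (Cons x p)
    then show ?case using \<open>P v\<close> step
      by (fastforce simp: gwalk_Cons linked_def)
  qed
qed

text \<open>A walk can be shortened until it crosses the new edge at most once, in one direction or
  the other.\<close>

lemma linked_insert:
  "linked (insert {a, b} F) x y \<longleftrightarrow>
     linked F x y \<or> linked F x a \<and> linked F b y \<or> linked F x b \<and> linked F a y"
proof
  assume "linked (insert {a, b} F) x y"
  then show "linked F x y \<or> linked F x a \<and> linked F b y \<or> linked F x b \<and> linked F a y"
  proof (induction rule: linked_induct)
    case refl
    show ?case by simp
  next
    case (step x z)
    from step(1) consider "{x, z} \<in> F" | "x = a" "z = b" | "x = b" "z = a"
      by (auto simp: doubleton_eq_iff)
    then show ?case
    proof cases
      case 1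
      then show ?thesis using step(3) linked_edge linked_trans by blast
    qed (use step(3) in \<open>auto intro: linked_trans linked_sym\<close>)
  qed
next
  have "linked (insert {a, b} F) a b" by (simp add: linked_edge)
  then show "linked F x y \<or> linked F x a \<and> linked F b y \<or> linked F x b \<and> linked F a y \<Longrightarrow>
      linked (insert {a, b} F) x y"
    by (meson linked_mono linked_sym linked_trans subset_insertI)
qed

text \<open>Cutting out closed detours never lengthens a walk. The length bound is kept for the
  breadth-first search tree.\<close>

lemma gwalk_imp_gpath:
  assumes "gwalk F u p v"
  shows "\<exists>q. gpath F u q v \<and> length q \<le> length p"
  using assms
proof (induction p arbitrary: u)
  case Nil
  then show ?case by (simp add: gwalk_def)
next
  case (Cons x p)
  show ?case
  proof (cases "p = []")
    case True
    then show ?thesis using Cons.prems by (intro exI[of _ "[x]"]) (auto simp: gpath_def gwalk_def)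
  next
    case False
    then have *: "x = u" "{u, hd p} \<in> F" "gwalk F (hd p) p v"
      using Cons.prems by (auto simp: gwalk_Cons)
    obtain q where q: "gpath F (hd p) q v" "length q \<le> length p"
      using Cons.IH[OF *(3)] by blast
    show ?thesis
    proof (cases "u \<in> set q")
      case True
      then obtain ys zs where "q = ys @ u # zs" by (auto simp: in_set_conv_decomp)
      then show ?thesis using q
        by (intro exI[of _ "u # zs"]) (auto simp: gpath_def gwalk_def successively_append_iff)
    next
      case False
      have "q \<noteq> []" "hd q = hd p" using q by (auto simp: gpath_def gwalk_def)
      then show ?thesis using q False *
        by (intro exI[of _ "u # q"]) (auto simp: gpath_def gwalk_Cons)
    qed
  qed
qed

lemma linked_imp_gpath: "linked F u v \<Longrightarrow> \<exists>q. gpath F u q v"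
  unfolding linked_def using gwalk_imp_gpath by blast

section \<open>Acyclicity, spanning trees and two-tree forests in terms of connectivity\<close>

definition all_bridges :: "'a::finite set set \<Rightarrow> bool" where
  "all_bridges F \<longleftrightarrow> (\<forall>a b. {a, b} \<in> F \<longrightarrow> \<not> linked (F - {{a, b}}) a b)"

text \<open>A path joining the ends of a deleted edge closes to a cycle with that edge; conversely,
  a cycle without its closing edge still joins the ends of that edge. The bridge form suits deletion
  and insertion of single edges.\<close>

lemma acyclic_iff_all_bridges:
  assumes "simple_graph F"
  shows "acyclic_graph F \<longleftrightarrow> all_bridges F"
proof
  assume ac: "acyclic_graph F"
  show "all_bridges F"
    unfolding all_bridges_def
  proof (intro allI impI notI)
    fix a b assume ab: "{a, b} \<in> F" and l: "linked (F - {{a, b}}) a b"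
    have "card {a, b} = 2" using ab assms by (auto simp: simple_graph_def)
    then have ne: "a \<noteq> b" by auto
    obtain p where p: "gpath (F - {{a, b}}) a p b" using linked_imp_gpath[OF l] by blast
    then have w: "p \<noteq> []" "hd p = a" "last p = b" "distinct p"
        "successively (\<lambda>x y. {x, y} \<in> F - {{a, b}}) p"
      by (auto simp: gpath_def gwalk_def)
    \<comment> \<open>The ends differ, and a two-vertex path would use the deleted edge
      itself.\<close>
    have "length p \<ge> 3"
    proof (rule ccontr)
      assume "\<not> 3 \<le> length p"
      then obtain x y where "p = [] \<or> p = [x] \<or> p = [x, y]"
        by (cases p; cases "tl p"; cases "tl (tl p)") auto
      then show False using w ne by auto
    qed
    moreover have "successively (\<lambda>x y. {x, y} \<in> F) p"
      using w(5) by (rule successively_mono) auto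
    ultimately have "gcycle F p"
      using w ab by (auto simp: gcycle_def insert_commute)
    then show False using ac by (auto simp: acyclic_graph_def)
  qed
next
  assume br: "all_bridges F"
  show "acyclic_graph F"
    unfolding acyclic_graph_def
  proof
    assume "\<exists>c. gcycle F c"
    then obtain c where c: "length c \<ge> 3" "distinct c" "{last c, hd c} \<in> F"
        "successively (\<lambda>x y. {x, y} \<in> F) c"
      by (auto simp: gcycle_def)
    then have ne: "c \<noteq> []" by auto
    have "{c ! i, c ! Suc i} \<noteq> {hd c, last c}" if i: "Suc i < length c" for i
    proof
      assume "{c ! i, c ! Suc i} = {hd c, last c}"
      then have "{c ! i, c ! Suc i} = {c ! 0, c ! (length c - 1)}"
        using ne by (simp add: hd_conv_nth last_conv_nth)
      then have "i = 0 \<and> Suc i = length c - 1 \<or> i = length c - 1 \<and> Suc i = 0"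
        using c(1,2) i nth_eq_iff_index_eq[OF c(2)] ne unfolding doubleton_eq_iff
        by (metis Suc_lessD diff_less length_greater_0_conv zero_less_one)
      then show False using c(1) by auto
    qed
    then have "successively (\<lambda>x y. {x, y} \<in> F - {{hd c, last c}}) c"
      using c(4) by (auto simp: successively_conv_nth)
    then have "linked (F - {{hd c, last c}}) (hd c) (last c)"
      using ne by (auto simp: linked_def gwalk_def)
    moreover have "{hd c, last c} \<in> F" using c(3) by (simp add: insert_commute)
    ultimately show False using br by (auto simp: all_bridges_def)
  qed
qed

lemma simple_graph_subset: "simple_graph E \<Longrightarrow> F \<subseteq> E \<Longrightarrow> simple_graph F"
  by (auto simp: simple_graph_def)

lemma spanning_trees_iff:
  assumes "simple_graph E"
  shows "\<tau> \<in> spanning_trees E \<longleftrightarrow> \<tau> \<subseteq> E \<and> (\<forall>u v. linked \<tau> u v) \<and> all_bridges \<tau>"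
  unfolding spanning_trees_def connected_graph_def linked_def
  using acyclic_iff_all_bridges simple_graph_subset[OF assms] by blast

text \<open>No trees are counted: an unlinked pair forces at least two components, and a linked pair
  among any three vertices forces at most two.\<close>

definition two_forests :: "'a::finite set set \<Rightarrow> 'a set set set" where
  "two_forests E = {F. F \<subseteq> E \<and> all_bridges F \<and> (\<exists>a b. \<not> linked F a b) \<and>
     (\<forall>x y z. linked F x y \<or> linked F y z \<or> linked F x z)}"

lemma two_forests_trichotomy:
  "F \<in> two_forests E \<Longrightarrow> linked F x y \<or> linked F y z \<or> linked F x z"
  by (auto simp: two_forests_def)

lemma remove_edge_two_forest:
  assumes "simple_graph E" "\<tau> \<in> spanning_trees E" "{a, b} \<in> \<tau>"
  shows "\<tau> - {{a, b}} \<in> two_forests E" and "\<not> linked (\<tau> - {{a, b}}) a b"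
proof -
  let ?F = "\<tau> - {{a, b}}"
  have \<tau>: "\<tau> \<subseteq> E" "\<And>u v. linked \<tau> u v" "all_bridges \<tau>"
    using assms(2) spanning_trees_iff[OF assms(1)] by auto
  show nl: "\<not> linked ?F a b"
    using \<tau>(3) assms(3) by (auto simp: all_bridges_def)
  have ins: "insert {a, b} ?F = \<tau>" using assms(3) by auto
  \<comment> \<open>Putting the edge back restores \<open>\<tau>\<close>, so a walk to
    \<open>a\<close> in \<open>\<tau>\<close> reaches \<open>a\<close> or \<open>b\<close> before
    using that edge.\<close>
  have "linked ?F x a \<or> linked ?F x b" for x
    using \<tau>(2)[of x a] linked_insert[of a b ?F x a] unfolding ins by auto
  then have tri: "linked ?F x y \<or> linked ?F y z \<or> linked ?F x z" for x y z
    by (meson linked_sym linked_trans)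
  have "all_bridges ?F"
    unfolding all_bridges_def
  proof (intro allI impI notI)
    fix c d assume "{c, d} \<in> ?F" "linked (?F - {{c, d}}) c d"
    then have "{c, d} \<in> \<tau>" "linked (\<tau> - {{c, d}}) c d"
      using linked_mono[of "?F - {{c, d}}" c d "\<tau> - {{c, d}}"] by auto
    then show False using \<tau>(3) by (auto simp: all_bridges_def)
  qed
  then show "?F \<in> two_forests E"
    using \<tau>(1) nl tri by (auto simp: two_forests_def)
qed

lemma insert_edge_spanning_tree:
  assumes "simple_graph E" "F \<in> two_forests E" "{a, b} \<in> E" "\<not> linked F a b"
  shows "insert {a, b} F \<in> spanning_trees E"
proof -
  have F: "F \<subseteq> E" "all_bridges F" using assms(2) by (auto simp: two_forests_def)
  have "linked (insert {a, b} F) x y" for x y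
    using two_forests_trichotomy[OF assms(2), of x a b] two_forests_trichotomy[OF assms(2), of y a b]
      two_forests_trichotomy[OF assms(2), of x y a] two_forests_trichotomy[OF assms(2), of x y b]
      assms(4)
    unfolding linked_insert by (meson linked_sym linked_trans)
  moreover have "all_bridges (insert {a, b} F)"
    unfolding all_bridges_def
  proof (intro allI impI notI)
    fix c d assume cd: "{c, d} \<in> insert {a, b} F" "linked (insert {a, b} F - {{c, d}}) c d"
    show False
    proof (cases "{c, d} = {a, b}")
      case True
      then have "linked F c d" using cd(2) by (auto elim: linked_mono)
      then show False using True assms(4) by (auto simp: doubleton_eq_iff dest: linked_sym)
    next
      case False
      let ?F' = "F - {{c, d}}"
      have mem: "{c, d} \<in> F" and eq: "insert {a, b} F - {{c, d}} = insert {a, b} ?F'"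
        using cd(1) False by auto
      \<comment> \<open>A detour around an old edge would have to use the new edge; together with
        \<open>{c, d}\<close> it would link \<open>a\<close> to \<open>b\<close> already in
        \<open>F\<close>.\<close>
      have "\<not> linked ?F' c d" using F(2) mem by (auto simp: all_bridges_def)
      then have "linked ?F' c a \<and> linked ?F' b d \<or> linked ?F' c b \<and> linked ?F' a d"
        using cd(2) unfolding eq linked_insert by blast
      then have "linked F c a \<and> linked F b d \<or> linked F c b \<and> linked F a d"
        by (meson Diff_subset linked_mono)
      then show False using linked_edge[OF mem] assms(4) by (meson linked_sym linked_trans)
    qed
  qed
  ultimately show ?thesis using F(1) assms(3) by (simp add: spanning_trees_iff[OF assms(1)])
qed

section \<open>Arcs of tree paths and the exchange of trees and forests\<close>

lemma path_arcs_Cons: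
  "path_arcs (x # p) = (if p = [] then {} else insert (x, hd p) (path_arcs p))"
  by (cases p) (auto simp: path_arcs_def)

lemma path_arcs_iff_nth:
  "(a, b) \<in> path_arcs p \<longleftrightarrow> (\<exists>k. Suc k < length p \<and> a = p ! k \<and> b = p ! Suc k)"
proof -
  have "(a, b) \<in> path_arcs p \<longleftrightarrow> (\<exists>k. k < length p \<and> k < length (tl p) \<and> a = p ! k \<and> b = tl p ! k)"
    by (auto simp: path_arcs_def in_set_zip)
  also have "\<dots> \<longleftrightarrow> (\<exists>k. Suc k < length p \<and> a = p ! k \<and> b = p ! Suc k)"
    by (intro ex_cong1) (auto simp: nth_tl)
  finally show ?thesis .
qed

lemma path_arcs_split:
  assumes "(a, b) \<in> path_arcs p"
  obtains xs ys where "p = xs @ a # b # ys"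
proof -
  obtain k where k: "Suc k < length p" "a = p ! k" "b = p ! Suc k"
    using assms by (auto simp: path_arcs_iff_nth)
  then have "p = take k p @ a # b # drop (Suc (Suc k)) p"
    by (metis Cons_nth_drop_Suc Suc_lessD append_take_drop_id)
  then show ?thesis using that by blast
qed

lemma gwalk_avoiding_edge:
  assumes "gwalk F u p v" "\<And>x y. (x, y) \<in> path_arcs p \<Longrightarrow> {x, y} \<noteq> e"
  shows "linked (F - {e}) u v"
proof -
  have "successively (\<lambda>x y. {x, y} \<in> F - {e}) p"
    using assms unfolding gwalk_def successively_conv_nth path_arcs_iff_nth by blast
  then show ?thesis using assms(1) by (auto simp: linked_def gwalk_def)
qed

text \<open>An arc of a path is recognised, with its orientation, by what its deletion separates:
  \<open>u\<close> stays with the tail \<open>a\<close>, and \<open>v\<close> with the head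
  \<open>b\<close>. This replaces lists by connectivity in the later counting.\<close>

lemma path_arcs_gpath_iff:
  assumes br: "all_bridges F" and p: "gpath F u p v"
  shows "(a, b) \<in> path_arcs p \<longleftrightarrow>
    {a, b} \<in> F \<and> linked (F - {{a, b}}) u a \<and> linked (F - {{a, b}}) b v"
proof -
  have fwd: "{a, b} \<in> F \<and> linked (F - {{a, b}}) u a \<and> linked (F - {{a, b}}) b v"
    if "(a, b) \<in> path_arcs p" for a b
  proof -
    obtain xs ys where sp: "p = xs @ a # b # ys" using path_arcs_split \<open>(a, b) \<in> path_arcs p\<close> by metis
    have w: "gwalk F u (xs @ [a]) a" "gwalk F b (b # ys) v" "{a, b} \<in> F" and d: "distinct p"
      using p unfolding sp gpath_def gwalk_def
      by (auto simp: successively_append_iff hd_append split: if_splits)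
    have "linked (F - {{a, b}}) u a"
    proof (rule gwalk_avoiding_edge[OF w(1)])
      fix x y assume "(x, y) \<in> path_arcs (xs @ [a])"
      then have "x \<in> set (xs @ [a])" "y \<in> set (xs @ [a])" by (auto simp: path_arcs_iff_nth simp del: set_append intro: nth_mem)
      then show "{x, y} \<noteq> {a, b}" using d sp by (auto simp: doubleton_eq_iff)
    qed
    moreover have "linked (F - {{a, b}}) b v"
    proof (rule gwalk_avoiding_edge[OF w(2)])
      fix x y assume "(x, y) \<in> path_arcs (b # ys)"
      then have "x \<in> set (b # ys)" "y \<in> set (b # ys)" unfolding path_arcs_iff_nth by (metis Suc_lessD nth_mem)+
      then show "{x, y} \<noteq> {a, b}" using d sp by (auto simp: doubleton_eq_iff)
    qed
    ultimately show ?thesis using w(3) by blast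
  qed
  show ?thesis
  proof
    assume r: "{a, b} \<in> F \<and> linked (F - {{a, b}}) u a \<and> linked (F - {{a, b}}) b v"
    then have nl: "\<not> linked (F - {{a, b}}) a b" using br by (auto simp: all_bridges_def)
    show "(a, b) \<in> path_arcs p"
    proof (rule ccontr)
      assume no: "(a, b) \<notin> path_arcs p"
      \<comment> \<open>The reverse arc would put \<open>u\<close> on the side of \<open>b\<close>
        and so link \<open>a\<close> to \<open>b\<close>. If neither orientation occurs, the path
        survives the deletion and links them too.\<close>
      have "(b, a) \<notin> path_arcs p"
        using fwd[of b a] r nl by (metis insert_commute linked_sym linked_trans)
      then have "linked (F - {{a, b}}) u v"
        using p no by (intro gwalk_avoiding_edge[of F u p v]) (auto simp: gpath_def doubleton_eq_iff)
      then show False using r nl by (meson linked_sym linked_trans)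
    qed
  qed (rule fwd)
qed

text \<open>The head has only one outgoing arc, which determines the next vertex; removing it from
  both arc sets leaves the same problem for the tails.\<close>

lemma distinct_path_arcs_unique:
  assumes "distinct p" "distinct q" "p \<noteq> []" "q \<noteq> []" "hd p = hd q" "path_arcs p = path_arcs q"
  shows "p = q"
  using assms
proof (induction p arbitrary: q)
  case Nil
  then show ?case by simp
next
  case (Cons x p)
  obtain q' where q: "q = x # q'" using Cons.prems by (cases q) auto
  have src: "a \<in> set s" if "(a, b) \<in> path_arcs s" for a b and s :: "'a list"
    using that by (auto simp: path_arcs_iff_nth)
  show ?case
  proof (cases "p = [] \<or> q' = []")
    case True
    then show ?thesis using Cons.prems(6) q by (auto simp: path_arcs_Cons split: if_splits)
  next
    case False
    then have eq: "insert (x, hd p) (path_arcs p) = insert (x, hd q') (path_arcs q')"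
      using Cons.prems(6) q by (simp add: path_arcs_Cons)
    have nx: "(x, y) \<notin> path_arcs p" "(x, y) \<notin> path_arcs q'" for y
      using Cons.prems(1,2) q src by fastforce+
    have "hd p = hd q'" using eq nx by blast
    moreover have "path_arcs p = path_arcs q'"
      using eq nx calculation by (metis insert_ident)
    ultimately show ?thesis using Cons.IH[of q'] Cons.prems(1,2) False q by auto
  qed
qed

lemma gpath_unique:
  assumes "all_bridges F" "gpath F u p v" "gpath F u q v"
  shows "p = q"
proof -
  have "path_arcs p = path_arcs q"
    using path_arcs_gpath_iff[OF assms(1,2)] path_arcs_gpath_iff[OF assms(1,3)] by auto
  then show ?thesis
    using assms(2,3) by (intro distinct_path_arcs_unique) (auto simp: gpath_def gwalk_def)
qed

lemma gpath_tree_path: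
  assumes "simple_graph E" "\<tau> \<in> spanning_trees E"
  shows "gpath \<tau> u (tree_path \<tau> u v) v"
proof -
  have \<tau>: "linked \<tau> u v" "all_bridges \<tau>"
    using assms spanning_trees_iff by blast+
  then have "\<exists>!p. gpath \<tau> u p v" using linked_imp_gpath gpath_unique by blast
  then show ?thesis unfolding tree_path_def by (rule theI')
qed

lemma path_arcs_tree_path_iff:
  assumes "simple_graph E" "\<tau> \<in> spanning_trees E"
  shows "(a, b) \<in> path_arcs (tree_path \<tau> u v) \<longleftrightarrow>
    {a, b} \<in> \<tau> \<and> linked (\<tau> - {{a, b}}) u a \<and> linked (\<tau> - {{a, b}}) b v"
  using path_arcs_gpath_iff[OF _ gpath_tree_path[OF assms]] assms spanning_trees_iff by blast

text \<open>Double counting: delete an arc of the tree path, or insert an arc of \<open>E\<close>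
  leading from the component of \<open>u\<close> to that of \<open>v\<close>. The arc is carried
  along in the pair, so the two operations are mutually inverse. The weight \<open>c\<close> sees
  only the arc, and \<open>g\<close> only the forest.\<close>

lemma sum_tree_arcs_eq_sum_two_forests:
  fixes g :: "'a::finite set set \<Rightarrow> real" and c :: "'a \<times> 'a \<Rightarrow> real"
  assumes E: "simple_graph E"
  shows "(\<Sum>\<tau>\<in>spanning_trees E. \<Sum>x\<in>path_arcs (tree_path \<tau> u v). c x * g (\<tau> - {{fst x, snd x}})) =
    (\<Sum>F\<in>{F \<in> two_forests E. \<not> linked F u v}.
       (\<Sum>x\<in>{(a, b). {a, b} \<in> E \<and> linked F u a \<and> linked F b v}. c x) * g F)"
proof -
  let ?R = "{F \<in> two_forests E. \<not> linked F u v}"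
  let ?B = "\<lambda>F. {(a, b). {a, b} \<in> E \<and> linked F u a \<and> linked F b v}"
  let ?A = "\<lambda>\<tau>. path_arcs (tree_path \<tau> u v)"
  let ?i = "\<lambda>(F, x). (insert {fst x, snd x} F, x)" and ?j = "\<lambda>(\<tau>, x). (\<tau> - {{fst x, snd x}}, x)"
  have "(\<Sum>\<tau>\<in>spanning_trees E. \<Sum>x\<in>?A \<tau>. c x * g (\<tau> - {{fst x, snd x}})) =
      (\<Sum>(\<tau>, x)\<in>Sigma (spanning_trees E) ?A. c x * g (\<tau> - {{fst x, snd x}}))"
    by (rule sum.Sigma) auto
  also have "\<dots> = (\<Sum>(F, x)\<in>Sigma ?R ?B. c x * g F)"
  proof (rule sum.reindex_bij_witness[where i = ?i and j = ?j])
    fix y assume y: "y \<in> Sigma (spanning_trees E) ?A"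
    obtain \<tau> a b where ye: "y = (\<tau>, (a, b))" by (cases y) auto
    have \<tau>: "\<tau> \<in> spanning_trees E"
      and ab: "{a, b} \<in> \<tau>" "linked (\<tau> - {{a, b}}) u a" "linked (\<tau> - {{a, b}}) b v"
      using y path_arcs_tree_path_iff[OF E] ye by auto
    note rem = remove_edge_two_forest[OF E \<tau>(1) ab(1)]
    have "\<not> linked (\<tau> - {{a, b}}) u v"
      using rem(2) ab by (meson linked_sym linked_trans)
    moreover have "{a, b} \<in> E" using \<tau>(1) ab(1) by (auto simp: spanning_trees_def)
    ultimately show "?j y \<in> Sigma ?R ?B"
      using rem(1) ab ye by auto
    show "?i (?j y) = y"
      using ab ye by auto
    show "(case ?j y of (F, x) \<Rightarrow> c x * g F) = (case y of (\<tau>, x) \<Rightarrow> c x * g (\<tau> - {{fst x, snd x}}))"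
      using ye by simp
  next
    fix y assume y: "y \<in> Sigma ?R ?B"
    obtain F a b where ye: "y = (F, (a, b))" by (cases y) auto
    have F: "F \<in> two_forests E" "\<not> linked F u v"
      "{a, b} \<in> E" "linked F u a" "linked F b v"
      using y ye by auto
    have nl: "\<not> linked F a b" using F by (meson linked_trans)
    then have "{a, b} \<notin> F" using linked_edge by blast
    then have del: "insert {a, b} F - {{a, b}} = F" by auto
    note tree = insert_edge_spanning_tree[OF E F(1,3) nl]
    show "?i y \<in> Sigma (spanning_trees E) ?A"
      using tree F del ye path_arcs_tree_path_iff[OF E tree] by simp
    show "?j (?i y) = y"
      using ye del by simp
  qed
  also have "\<dots> = (\<Sum>F\<in>?R. \<Sum>x\<in>?B F. c x * g F)"
    by (rule sum.Sigma[symmetric]) auto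
  finally show ?thesis by (simp add: sum_distrib_right)
qed

subsection \<open>Forest counts and hitting times\<close>

lemma sum_path_arcs_telescope:
  fixes f :: "'a \<Rightarrow> real"
  assumes "distinct p" "p \<noteq> []"
  shows "(\<Sum>x\<in>path_arcs p. f (fst x) - f (snd x)) = f (hd p) - f (last p)"
  using assms
proof (induction p)
  case (Cons x p)
  show ?case
  proof (cases "p = []")
    case True
    then show ?thesis by (simp add: path_arcs_def)
  next
    case False
    have fin: "finite (path_arcs p)" by (simp add: path_arcs_def)
    have "(x, hd p) \<notin> path_arcs p"
      using Cons.prems(1) by (auto simp: path_arcs_iff_nth)
    then show ?thesis using Cons False fin by (simp add: path_arcs_Cons)
  qed
qed simp

lemma linked_two_forest_iff:
  assumes "F \<in> two_forests E" "\<not> linked F u v"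
  shows "linked F w v \<longleftrightarrow> \<not> linked F u w"
  using two_forests_trichotomy[OF assms(1), of u w v] assms(2) by (meson linked_sym linked_trans)

lemma tree_of_eq: "tree_of F u = {v. linked F u v}"
  by (auto simp: tree_of_def linked_def)

lemma vol_eq_sum_indicator: "real (vol E S) = (\<Sum>v\<in>UNIV. real (vdegree E v) * of_bool (v \<in> S))"
  for S :: "'a::finite set"
  unfolding vol_def of_nat_sum by (rule sum.mono_neutral_cong_left) auto

definition hitting_potential :: "'a::finite set set \<Rightarrow> 'a \<Rightarrow> 'a \<Rightarrow> real" where
  "hitting_potential E v i =
     (\<Sum>F\<in>{F \<in> two_forests E. \<not> linked F i v}. real (vol E (tree_of F i))) / real (card (spanning_trees E))"

lemma hitting_potential_self [simp]: "hitting_potential E v v = 0"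
  by (simp add: hitting_potential_def)

lemma hitting_potential_nonneg: "hitting_potential E v i \<ge> 0"
  by (auto simp: hitting_potential_def intro!: divide_nonneg_nonneg sum_nonneg)

text \<open>Kirchhoff's current law. Divided by the number of spanning trees, the number of forests
  separating \<open>v\<close> from \<open>j\<close> with \<open>i\<close> on the side of
  \<open>v\<close> is the voltage at \<open>i\<close> when a unit current enters at \<open>v\<close>
  and leaves at the grounded \<open>j\<close>.\<close>

lemma sum_two_forests_neighbor_difference:
  fixes i j v :: "'a::finite"
  assumes E: "simple_graph E" and "i \<noteq> j"
  shows "(\<Sum>F\<in>{F \<in> two_forests E. \<not> linked F v j}.
      \<Sum>k\<in>neighbors E i. of_bool (linked F v i) - of_bool (linked F v k)) =
    real (card (spanning_trees E)) * of_bool (i = v)"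
proof -
  let ?R = "{F \<in> two_forests E. \<not> linked F v j}"
  \<comment> \<open>The weight is the divergence at \<open>i\<close>: along a path from
    \<open>v\<close> to \<open>j\<close> it telescopes to \<open>of_bool (i = v)\<close>, as
    \<open>i \<noteq> j\<close>.\<close>
  let ?c = "\<lambda>x :: 'a \<times> 'a. of_bool (fst x = i) - of_bool (snd x = i) :: real"
  have inner: "(\<Sum>x\<in>{(a, b). {a, b} \<in> E \<and> linked F v a \<and> linked F b j}. ?c x) =
      (\<Sum>k\<in>neighbors E i. of_bool (linked F v i) - of_bool (linked F v k))" if F: "F \<in> ?R" for F
  proof -
    let ?B = "{(a, b). {a, b} \<in> E \<and> linked F v a \<and> linked F b j}"
    have lj: "linked F w j \<longleftrightarrow> \<not> linked F v w" for w
      using linked_two_forest_iff F by blast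
    have 1: "(\<Sum>x\<in>?B. of_bool (fst x = i) :: real) =
        (\<Sum>k\<in>neighbors E i. of_bool (linked F v i \<and> \<not> linked F v k))"
    proof -
      have "(\<Sum>x\<in>?B. of_bool (fst x = i) :: real) = (\<Sum>x\<in>{x\<in>?B. fst x = i}. 1)"
        by (rule sum.mono_neutral_cong_right) auto
      also have "\<dots> = (\<Sum>k\<in>{k\<in>neighbors E i. linked F v i \<and> \<not> linked F v k}. 1)"
        by (rule sum.reindex_bij_witness[where i = "\<lambda>k. (i, k)" and j = snd])
           (auto simp: neighbors_def lj)
      also have "\<dots> = (\<Sum>k\<in>neighbors E i. of_bool (linked F v i \<and> \<not> linked F v k))"
        by (rule sum.mono_neutral_cong_left) auto
      finally show ?thesis .
    qed
    have 2: "(\<Sum>x\<in>?B. of_bool (snd x = i) :: real) =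
        (\<Sum>k\<in>neighbors E i. of_bool (\<not> linked F v i \<and> linked F v k))"
    proof -
      have "(\<Sum>x\<in>?B. of_bool (snd x = i) :: real) = (\<Sum>x\<in>{x\<in>?B. snd x = i}. 1)"
        by (rule sum.mono_neutral_cong_right) auto
      also have "\<dots> = (\<Sum>k\<in>{k\<in>neighbors E i. \<not> linked F v i \<and> linked F v k}. 1)"
        by (rule sum.reindex_bij_witness[where i = "\<lambda>k. (k, i)" and j = fst])
           (auto simp: neighbors_def lj insert_commute)
      also have "\<dots> = (\<Sum>k\<in>neighbors E i. of_bool (\<not> linked F v i \<and> linked F v k))"
        by (rule sum.mono_neutral_cong_left) auto
      finally show ?thesis .
    qed
    show ?thesis
      unfolding sum_subtractf 1 2 unfolding sum_subtractf[symmetric]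
      by (rule sum.cong) auto
  qed
  have "(\<Sum>F\<in>?R. \<Sum>k\<in>neighbors E i. of_bool (linked F v i) - of_bool (linked F v k)) =
      (\<Sum>F\<in>?R. (\<Sum>x\<in>{(a, b). {a, b} \<in> E \<and> linked F v a \<and> linked F b j}. ?c x) * 1)"
    using inner by (intro sum.cong) auto
  also have "\<dots> = (\<Sum>\<tau>\<in>spanning_trees E. \<Sum>x\<in>path_arcs (tree_path \<tau> v j). ?c x * 1)"
    by (rule sum_tree_arcs_eq_sum_two_forests[OF E, symmetric])
  also have "\<dots> = (\<Sum>\<tau>\<in>spanning_trees E. of_bool (i = v))"
  proof (rule sum.cong)
    fix \<tau> assume "\<tau> \<in> spanning_trees E"
    then have p: "gpath \<tau> v (tree_path \<tau> v j) j" by (rule gpath_tree_path[OF E])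
    then show "(\<Sum>x\<in>path_arcs (tree_path \<tau> v j). ?c x * 1) = of_bool (i = v)"
      using sum_path_arcs_telescope[of "tree_path \<tau> v j" "\<lambda>a. of_bool (a = i)"] \<open>i \<noteq> j\<close>
      by (auto simp: gpath_def gwalk_def)
  qed simp
  finally show ?thesis by simp
qed

text \<open>The volume is expanded over its vertices \<open>v\<close>, and each forest is viewed
  from \<open>v\<close> instead of \<open>i\<close>. The potential becomes a superposition of
  voltages, with current \<open>vdegree E v\<close> entering at each \<open>v\<close>.\<close>

lemma hitting_potential_altdef:
  "real (card (spanning_trees E)) * hitting_potential E j i =
    (\<Sum>v\<in>UNIV. real (vdegree E v) * (\<Sum>F\<in>{F \<in> two_forests E. \<not> linked F v j}. of_bool (linked F v i)))"
  if "spanning_trees E \<noteq> {}" for i j :: "'a::finite"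
proof -
  have "real (card (spanning_trees E)) * hitting_potential E j i =
      (\<Sum>F\<in>{F \<in> two_forests E. \<not> linked F i j}. \<Sum>v\<in>UNIV. real (vdegree E v) * of_bool (linked F i v))"
    using that by (simp add: hitting_potential_def vol_eq_sum_indicator tree_of_eq card_gt_0_iff)
  also have "\<dots> = (\<Sum>v\<in>UNIV. real (vdegree E v) * (\<Sum>F\<in>{F \<in> two_forests E. \<not> linked F i j}. of_bool (linked F i v)))"
    unfolding sum_distrib_left by (rule sum.swap)
  also have "\<dots> = (\<Sum>v\<in>UNIV. real (vdegree E v) * (\<Sum>F\<in>{F \<in> two_forests E. \<not> linked F v j}. of_bool (linked F v i)))"
  proof (rule sum.cong[OF refl], rule arg_cong2[OF refl, where f = "(*)"])
    fix v
    have "(\<Sum>F\<in>{F \<in> two_forests E. \<not> linked F i j}. of_bool (linked F i v)) =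
        (\<Sum>F\<in>{F \<in> two_forests E. \<not> linked F i j \<and> linked F i v}. 1 :: real)"
      by (rule sum.mono_neutral_cong_right) auto
    also have "\<dots> = (\<Sum>F\<in>{F \<in> two_forests E. \<not> linked F v j \<and> linked F v i}. 1 :: real)"
      by (rule sum.cong) (auto intro: linked_sym linked_trans)
    also have "\<dots> = (\<Sum>F\<in>{F \<in> two_forests E. \<not> linked F v j}. of_bool (linked F v i))"
      by (rule sum.mono_neutral_cong_left) auto
    finally show "(\<Sum>F\<in>{F \<in> two_forests E. \<not> linked F i j}. of_bool (linked F i v)) =
        (\<Sum>F\<in>{F \<in> two_forests E. \<not> linked F v j}. of_bool (linked F v i) :: real)" .
  qed
  finally show ?thesis .
qed

text \<open>When the current laws are added up over all sources \<open>v\<close>, only the source at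
  \<open>i\<close> contributes.\<close>

lemma hitting_potential_harmonic:
  fixes i j :: "'a::finite"
  assumes E: "simple_graph E" and ne: "spanning_trees E \<noteq> {}" and ij: "i \<noteq> j"
  shows "(\<Sum>k\<in>neighbors E i. hitting_potential E j i - hitting_potential E j k) = real (vdegree E i)"
proof -
  let ?T = "real (card (spanning_trees E))"
  let ?R = "\<lambda>v. {F \<in> two_forests E. \<not> linked F v j}"
  have T: "?T > 0" using ne by (simp add: card_gt_0_iff)
  have "?T * (\<Sum>k\<in>neighbors E i. hitting_potential E j i - hitting_potential E j k) =
      (\<Sum>k\<in>neighbors E i. ?T * hitting_potential E j i - ?T * hitting_potential E j k)"
    by (simp add: sum_distrib_left right_diff_distrib)
  also have "\<dots> = (\<Sum>k\<in>neighbors E i. \<Sum>v\<in>UNIV. real (vdegree E v) *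
      (\<Sum>F\<in>?R v. of_bool (linked F v i) - of_bool (linked F v k)))"
    unfolding hitting_potential_altdef[OF ne] sum_subtractf[symmetric] right_diff_distrib[symmetric] ..
  also have "\<dots> = (\<Sum>v\<in>UNIV. real (vdegree E v) * (\<Sum>F\<in>?R v.
      \<Sum>k\<in>neighbors E i. of_bool (linked F v i) - of_bool (linked F v k)))"
    unfolding sum.swap[of _ _ "?R _"] by (subst sum.swap) (simp add: sum_distrib_left)
  also have "\<dots> = (\<Sum>v\<in>UNIV. if v = i then real (vdegree E v) * ?T else 0)"
    unfolding sum_two_forests_neighbor_difference[OF E ij] by (intro sum.cong) auto
  also have "\<dots> = ?T * real (vdegree E i)"
    by (simp add: sum.delta)
  finally show ?thesis using T by (metis mult_cancel_left less_irrefl)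
qed

section \<open>The forest weight as a sum of potentials and as the total of the statistic\<close>

definition forest_weight :: "'a::finite set set \<Rightarrow> 'a \<Rightarrow> real" where
  "forest_weight E r = (\<Sum>F\<in>two_forests E. real (vol E (tree_of F r)) * real (vol E (- tree_of F r)))"

text \<open>Roots in the same tree give the same product; for roots in different trees the two
  factors trade places.\<close>

lemma forest_weight_root_independent: "forest_weight E r = forest_weight E s"
  unfolding forest_weight_def
proof (rule sum.cong)
  fix F assume F: "F \<in> two_forests E"
  show "real (vol E (tree_of F r)) * real (vol E (- tree_of F r)) =
      real (vol E (tree_of F s)) * real (vol E (- tree_of F s))"
  proof (cases "linked F r s")
    case True
    then have "tree_of F r = tree_of F s"
      unfolding tree_of_eq by (auto intro: linked_sym linked_trans)
    then show ?thesis by simp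
  next
    case False
    have "tree_of F s = - tree_of F r"
      using linked_two_forest_iff[OF F False] linked_sym unfolding tree_of_eq by blast
    then show ?thesis by simp
  qed
qed simp

text \<open>For a fixed forest, the degrees of the vertices \<open>j\<close> separated from
  \<open>i\<close> add up to the volume of the other tree.\<close>

lemma sum_degree_hitting_potential:
  fixes i :: "'a::finite"
  assumes ne: "spanning_trees E \<noteq> {}"
  shows "(\<Sum>j\<in>UNIV. real (vdegree E j) * hitting_potential E j i) =
    forest_weight E i / real (card (spanning_trees E))"
proof -
  have "(\<Sum>j\<in>UNIV. real (vdegree E j) * (\<Sum>F\<in>{F \<in> two_forests E. \<not> linked F i j}. real (vol E (tree_of F i)))) =
      (\<Sum>j\<in>UNIV. \<Sum>F\<in>two_forests E. real (vdegree E j) * of_bool (\<not> linked F i j) * real (vol E (tree_of F i)))"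
    unfolding sum_distrib_left
    by (intro sum.cong refl sum.mono_neutral_cong_left) auto
  also have "\<dots> = (\<Sum>F\<in>two_forests E. real (vol E (tree_of F i)) *
      (\<Sum>j\<in>UNIV. real (vdegree E j) * of_bool (\<not> linked F i j)))"
    unfolding sum_distrib_left by (subst sum.swap) (simp only: mult_ac)
  also have "\<dots> = forest_weight E i"
    unfolding forest_weight_def vol_eq_sum_indicator[of E "- _"] by (simp add: tree_of_eq)
  finally show ?thesis
    by (simp add: hitting_potential_def sum_divide_distrib[symmetric])
qed

text \<open>Sums over sets of forests become sums over arcs, because deleting different arcs of one
  path leaves different forests. Both sums are indexed by arcs as directed in the tree path, hence
  the swap in the second.\<close>

lemma forest_sum_eq_path_arcs_sum:
  fixes u r :: "'a::finite" and g :: "'a set set \<Rightarrow> real"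
  assumes E: "simple_graph E" and \<tau>: "\<tau> \<in> spanning_trees E"
  shows "sum g (forests_along P u r \<tau>) =
      (\<Sum>x\<in>path_arcs (tree_path \<tau> u r). of_bool (x \<in> path_arcs P) * g (\<tau> - {{fst x, snd x}}))" (is ?along)
    and "sum g (forests_against P u r \<tau>) =
      (\<Sum>x\<in>path_arcs (tree_path \<tau> u r). of_bool (prod.swap x \<in> path_arcs P) * g (\<tau> - {{fst x, snd x}}))" (is ?against)
proof -
  let ?A = "path_arcs (tree_path \<tau> u r)"
  let ?f = "\<lambda>x. \<tau> - {{fst x, snd x}}"
  have inj: "inj_on ?f ?A"
  proof (rule inj_onI)
    fix x y assume x: "x \<in> ?A" and y: "y \<in> ?A" and eq: "?f x = ?f y"
    obtain a b c d where xy: "x = (a, b)" "y = (c, d)" by (cases x; cases y) auto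
    have ab: "{a, b} \<in> \<tau>" "linked (\<tau> - {{a, b}}) u a" "linked (\<tau> - {{a, b}}) b r"
      and cd: "{c, d} \<in> \<tau>" "linked (\<tau> - {{c, d}}) u c" "linked (\<tau> - {{c, d}}) d r"
      using x y path_arcs_tree_path_iff[OF E \<tau>] xy by auto
    have same: "{a, b} = {c, d}" using eq ab(1) cd(1) xy by auto
    \<comment> \<open>Opposite orientations of the same edge would place \<open>u\<close> on both of
      its sides.\<close>
    have "\<not> (a = d \<and> b = c)"
      using ab cd same remove_edge_two_forest(2)[OF E \<tau> ab(1)] by (metis linked_sym linked_trans)
    then show "x = y" using same xy by (auto simp: doubleton_eq_iff)
  qed
  have fin: "finite ?A" by (simp add: path_arcs_def)
  have eqs: "forests_along P u r \<tau> = ?f ` {x \<in> ?A. x \<in> path_arcs P}"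
    "forests_against P u r \<tau> = ?f ` {x \<in> ?A. prod.swap x \<in> path_arcs P}"
    unfolding forests_along_def forests_against_def
    by (force simp: image_iff insert_commute)+
  have image_sum: "sum g (?f ` {x \<in> ?A. Q x}) = (\<Sum>x\<in>?A. of_bool (Q x) * g (?f x))" for Q
  proof -
    have "sum g (?f ` {x \<in> ?A. Q x}) = (\<Sum>x\<in>{x \<in> ?A. Q x}. g (?f x))"
      by (subst sum.reindex) (auto intro: inj_on_subset[OF inj])
    also have "\<dots> = (\<Sum>x\<in>?A. of_bool (Q x) * g (?f x))"
      using fin by (intro sum.mono_neutral_cong_left) auto
    finally show ?thesis .
  qed
  show ?along unfolding eqs by (rule image_sum)
  show ?against unfolding eqs by (rule image_sum)
qed

text \<open>Net crossings are differences of the indicator of the tree of \<open>u\<close> along the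
  arcs of \<open>P\<close>; they telescope from 1 at \<open>u\<close> to 0 at
  \<open>r\<close>.\<close>

lemma net_crossings_eq_1:
  fixes u r :: "'a::finite"
  assumes F: "F \<in> two_forests E" "\<not> linked F u r"
    and P: "distinct P" "P \<noteq> []" "hd P = u" "last P = r" "\<And>a b. (a, b) \<in> path_arcs P \<Longrightarrow> {a, b} \<in> E"
  shows "(\<Sum>x\<in>{(a, b). {a, b} \<in> E \<and> linked F u a \<and> linked F b r}.
      of_bool (x \<in> path_arcs P) - of_bool (prod.swap x \<in> path_arcs P)) = (1 :: real)"
proof -
  let ?B = "{(a, b). {a, b} \<in> E \<and> linked F u a \<and> linked F b r}"
  have lr: "linked F w r \<longleftrightarrow> \<not> linked F u w" for w
    using linked_two_forest_iff F by blast
  have fin: "finite (path_arcs P)" by (simp add: path_arcs_def)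
  have 1: "(\<Sum>x\<in>?B. of_bool (x \<in> path_arcs P) :: real) =
      (\<Sum>x\<in>path_arcs P. of_bool (linked F u (fst x) \<and> \<not> linked F u (snd x)))"
  proof -
    have "(\<Sum>x\<in>?B. of_bool (x \<in> path_arcs P) :: real) = (\<Sum>x\<in>?B \<inter> path_arcs P. 1)"
      by (rule sum.mono_neutral_cong_right) auto
    also have "\<dots> = (\<Sum>x\<in>path_arcs P. of_bool (linked F u (fst x) \<and> \<not> linked F u (snd x)))"
      using fin P(5) by (intro sum.mono_neutral_cong_left) (auto simp: lr)
    finally show ?thesis .
  qed
  have 2: "(\<Sum>x\<in>?B. of_bool (prod.swap x \<in> path_arcs P) :: real) =
      (\<Sum>x\<in>path_arcs P. of_bool (linked F u (snd x) \<and> \<not> linked F u (fst x)))"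
  proof -
    have "(\<Sum>x\<in>?B. of_bool (prod.swap x \<in> path_arcs P) :: real) =
        (\<Sum>x\<in>{x \<in> ?B. prod.swap x \<in> path_arcs P}. 1)"
      by (rule sum.mono_neutral_cong_right) auto
    also have "\<dots> = (\<Sum>x\<in>{x \<in> path_arcs P. prod.swap x \<in> ?B}. 1)"
      by (rule sum.reindex_bij_witness[where i = prod.swap and j = prod.swap]) auto
    also have "\<dots> = (\<Sum>x\<in>path_arcs P. of_bool (linked F u (snd x) \<and> \<not> linked F u (fst x)))"
      using fin P(5) by (intro sum.mono_neutral_cong_left) (auto simp: lr insert_commute)
    finally show ?thesis .
  qed
  have "(\<Sum>x\<in>?B. of_bool (x \<in> path_arcs P) - of_bool (prod.swap x \<in> path_arcs P) :: real) =
      (\<Sum>x\<in>path_arcs P. of_bool (linked F u (fst x)) - of_bool (linked F u (snd x)))"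
    unfolding sum_subtractf 1 2 unfolding sum_subtractf[symmetric]
    by (rule sum.cong) auto
  also have "\<dots> = 1"
    using sum_path_arcs_telescope[OF P(1,2), of "\<lambda>a. of_bool (linked F u a)"] P(3,4) F(2) by simp
  finally show ?thesis .
qed

text \<open>After the exchange of trees for forests, each forest separating \<open>u\<close> from
  \<open>r\<close> counts exactly once, with the volume of the tree of \<open>r\<close>. The degrees
  of all such \<open>u\<close> add up to the volume of the other tree.\<close>

lemma sum_tree_stat:
  fixes r :: "'a::finite"
  assumes E: "simple_graph E" and \<tau>0: "\<tau>\<^sub>0 \<in> spanning_trees E"
  shows "(\<Sum>\<tau>\<in>spanning_trees E. tree_stat E r \<tau>\<^sub>0 \<tau>) = forest_weight E r"
proof -
  let ?P = "\<lambda>u. tree_path \<tau>\<^sub>0 u r"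
  let ?g = "\<lambda>F. real (vol E (tree_of F r))"
  let ?c = "\<lambda>u x. of_bool (x \<in> path_arcs (?P u)) - of_bool (prod.swap x \<in> path_arcs (?P u)) :: real"
  have stat: "tree_stat E r \<tau>\<^sub>0 \<tau> = (\<Sum>u\<in>UNIV - {r}. real (vdegree E u) *
      (\<Sum>x\<in>path_arcs (tree_path \<tau> u r). ?c u x * ?g (\<tau> - {{fst x, snd x}})))" if "\<tau> \<in> spanning_trees E" for \<tau>
    unfolding tree_stat_def forest_sum_eq_path_arcs_sum[OF E that] sum_subtractf[symmetric]
      left_diff_distrib[symmetric] ..
  have net: "(\<Sum>\<tau>\<in>spanning_trees E. \<Sum>x\<in>path_arcs (tree_path \<tau> u r). ?c u x * ?g (\<tau> - {{fst x, snd x}})) =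
      (\<Sum>F\<in>{F \<in> two_forests E. \<not> linked F u r}. ?g F)" for u
  proof -
    have P: "gpath \<tau>\<^sub>0 u (?P u) r" by (rule gpath_tree_path[OF E \<tau>0])
    have "{a, b} \<in> E" if "(a, b) \<in> path_arcs (?P u)" for a b
      using path_arcs_tree_path_iff[OF E \<tau>0] that \<tau>0 by (auto simp: spanning_trees_def)
    then show ?thesis
      unfolding sum_tree_arcs_eq_sum_two_forests[OF E, where c = "?c u" and g = ?g] using P
      by (intro sum.cong refl) (subst net_crossings_eq_1, auto simp: gpath_def gwalk_def)
  qed
  have "(\<Sum>\<tau>\<in>spanning_trees E. tree_stat E r \<tau>\<^sub>0 \<tau>) =
      (\<Sum>u\<in>UNIV - {r}. real (vdegree E u) * (\<Sum>F\<in>{F \<in> two_forests E. \<not> linked F u r}. ?g F))"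
    by (simp add: stat sum.swap[of _ _ "spanning_trees E"] sum_distrib_left[symmetric] net)
  \<comment> \<open>The term \<open>u = r\<close> may be added, since no forest separates
    \<open>r\<close> from itself.\<close>
  also have "\<dots> = (\<Sum>u\<in>UNIV. \<Sum>F\<in>two_forests E. real (vdegree E u) * of_bool (\<not> linked F u r) * ?g F)"
    unfolding sum_distrib_left
    by (intro sum.mono_neutral_cong_left ballI) (auto intro!: sum.mono_neutral_cong_left)
  also have "\<dots> = (\<Sum>F\<in>two_forests E. ?g F * (\<Sum>u\<in>UNIV. real (vdegree E u) * of_bool (\<not> linked F u r)))"
    unfolding sum_distrib_left by (subst sum.swap) (simp only: mult_ac)
  also have "\<dots> = forest_weight E r"
    unfolding forest_weight_def vol_eq_sum_indicator[of E "- _"] tree_of_eq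
    using linked_sym by (intro sum.cong refl arg_cong2[where f = "(*)"]) auto
  finally show ?thesis .
qed

subsection \<open>Expected hitting times of the random walk\<close>

text \<open>The probability that the hitting time exceeds \<open>t\<close>. Time 0 is included, so a
  start at \<open>j\<close> gives 0.\<close>

definition survival_prob :: "'a::finite set set \<Rightarrow> 'a \<Rightarrow> nat \<Rightarrow> 'a \<Rightarrow> real" where
  "survival_prob E j t i =
     measure (random_maps E) {\<omega> \<in> space (random_maps E). \<forall>s\<le>t. random_walk i \<omega> s \<noteq> j}"

lemma prob_space_random_maps: "prob_space (random_maps E)"
  unfolding random_maps_def by (rule prob_space.prob_space_stream_space[OF prob_space_measure_pmf])

lemma survival_prob_nonneg: "survival_prob E j t i \<ge> 0"
  by (simp add: survival_prob_def)

lemma survival_prob_0: "survival_prob E j 0 i = of_bool (i \<noteq> j)"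
proof -
  interpret prob_space "random_maps E" by (rule prob_space_random_maps)
  show ?thesis by (simp add: survival_prob_def prob_space)
qed

text \<open>First-step analysis: the stream splits off its first map, of which only the value at
  \<open>i\<close> matters, and that value is uniform on the neighbours of \<open>i\<close>.\<close>

lemma survival_prob_Suc:
  fixes E :: "'a::finite set set"
  assumes ne: "neighbors E i \<noteq> {}"
  shows "survival_prob E j (Suc t) i =
    of_bool (i \<noteq> j) * ((\<Sum>k\<in>neighbors E i. survival_prob E j t k) / real (vdegree E i))"
proof -
  let ?K = "measure_pmf (random_map_pmf E)"
  let ?A = "{\<omega> \<in> space (random_maps E). \<forall>s\<le>Suc t. random_walk i \<omega> s \<noteq> j}"
  interpret prob_space "random_maps E" by (rule prob_space_random_maps)
  have sp: "space (random_maps E) = UNIV"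
    by (simp add: random_maps_def space_stream_space)
  have "?A \<in> sets (random_maps E)"
    by measurable
  then have A: "?A \<in> sets (stream_space ?K)"
    by (simp add: random_maps_def)
  have all: "(\<forall>s\<le>Suc t. P s) \<longleftrightarrow> P 0 \<and> (\<forall>s\<le>t. P (Suc s))" for P
    by (metis Suc_le_mono le0 not0_implies_Suc)
  define q where "q k = ennreal (of_bool (i \<noteq> j) * survival_prob E j t k)" for k
  have "emeasure (random_maps E) ?A =
      (\<integral>\<^sup>+\<phi>. emeasure (random_maps E) {\<omega>\<in>space (random_maps E). \<phi> ## \<omega> \<in> ?A} \<partial>?K)"
    using prob_space.emeasure_stream_space[OF prob_space_measure_pmf A]
    by (simp add: random_maps_def)
  also have "\<dots> = (\<integral>\<^sup>+\<phi>. q (\<phi> i) \<partial>?K)"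
    by (intro nn_integral_cong)
       (auto simp: sp all random_walk_SCons q_def survival_prob_def emeasure_eq_measure
         simp del: random_walk.simps(2))
  also have "\<dots> = (\<integral>\<^sup>+k. q k \<partial>measure_pmf (map_pmf (\<lambda>\<phi>. \<phi> i) (random_map_pmf E)))"
    by simp
  also have "map_pmf (\<lambda>\<phi>. \<phi> i) (random_map_pmf E) = pmf_of_set (neighbors E i)"
    by (simp add: random_map_pmf_def Pi_pmf_component)
  also have "(\<integral>\<^sup>+k. q k \<partial>measure_pmf (pmf_of_set (neighbors E i))) =
      (\<Sum>k\<in>neighbors E i. q k) / of_nat (card (neighbors E i))"
    using ne by (simp add: nn_integral_pmf_of_set)
  also have "(\<Sum>k\<in>neighbors E i. q k) =
      ennreal (\<Sum>k\<in>neighbors E i. of_bool (i \<noteq> j) * survival_prob E j t k)"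
    unfolding q_def by (rule sum_ennreal) (simp add: survival_prob_nonneg)
  also have "\<dots> / of_nat (card (neighbors E i)) =
      ennreal ((\<Sum>k\<in>neighbors E i. of_bool (i \<noteq> j) * survival_prob E j t k) / real (vdegree E i))"
    using ne by (simp add: vdegree_def ennreal_of_nat_eq_real_of_nat divide_ennreal
        card_gt_0_iff sum_nonneg survival_prob_nonneg)
  finally have "measure (random_maps E) ?A =
      (\<Sum>k\<in>neighbors E i. of_bool (i \<noteq> j) * survival_prob E j t k) / real (vdegree E i)"
    unfolding emeasure_eq_measure
    by (subst (asm) ennreal_inj) (auto intro!: divide_nonneg_nonneg sum_nonneg survival_prob_nonneg)
  then show ?thesis
    unfolding survival_prob_def[of E j "Suc t"] by (simp add: sum_distrib_left[symmetric])
qed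

text \<open>The pointwise form of the tail formula for expectations: times before the first visit
  are counted one by one. Without a visit both sides are infinite.\<close>

lemma ennreal_hitting_time:
  "ennreal_of_enat (hitting_time X j) = (\<Sum>t. indicator {t. \<forall>s\<le>t. X s \<noteq> j} t)"
proof (cases "\<exists>t. X t = j")
  case False
  then have "hitting_time X j = \<infinity>" by (simp add: hitting_time_def top_enat_def[symmetric])
  moreover have "(\<Sum>t. indicator {t. \<forall>s\<le>t. X s \<noteq> j} t :: ennreal) = (\<Sum>t::nat. 1)"
    using False by (intro suminf_cong) auto
  ultimately show ?thesis by (simp add: nn_integral_count_space_nat[symmetric])
next
  case True
  define T where "T = (LEAST t. X t = j)"
  have T1: "X T = j" unfolding T_def by (rule LeastI_ex[OF True])
  have T2: "X s \<noteq> j" if "s < T" for s using that unfolding T_def by (rule not_less_Least)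
  have "hitting_time X j = enat T"
    unfolding hitting_time_def
  proof (rule antisym)
    show "Inf {enat t |t. X t = j} \<le> enat T" using T1 by (auto intro!: Inf_lower)
    show "enat T \<le> Inf {enat t |t. X t = j}"
    proof (rule Inf_greatest)
      fix x assume "x \<in> {enat t |t. X t = j}"
      then obtain t where t: "x = enat t" "X t = j" by blast
      then have "T \<le> t" using T2[of t] by (cases "t < T") auto
      then show "enat T \<le> x" by (simp add: t(1))
    qed
  qed
  moreover have "{t. \<forall>s\<le>t. X s \<noteq> j} = {..<T}"
  proof (intro equalityI subsetI)
    fix t assume "t \<in> {t. \<forall>s\<le>t. X s \<noteq> j}"
    then show "t \<in> {..<T}" using T1 by (cases "T \<le> t") auto
  next
    fix t assume "t \<in> {..<T}"
    then show "t \<in> {t. \<forall>s\<le>t. X s \<noteq> j}" using T2 order_le_less_trans by blast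
  qed
  moreover have "(\<Sum>t. indicator {..<T} t :: ennreal) = (\<Sum>t<T. indicator {..<T} t)"
    by (rule suminf_finite) auto
  ultimately show ?thesis by simp
qed

lemma expected_hitting_time_eq_suminf:
  "expected_hitting_time E i j = (\<Sum>t. ennreal (survival_prob E j t i))"
proof -
  interpret prob_space "random_maps E" by (rule prob_space_random_maps)
  have meas: "{\<omega> \<in> space (random_maps E). \<forall>s\<le>t. random_walk i \<omega> s \<noteq> j} \<in> sets (random_maps E)" for t
    by measurable
  have "expected_hitting_time E i j = (\<integral>\<^sup>+\<omega>. (\<Sum>t. indicator
      {\<omega> \<in> space (random_maps E). \<forall>s\<le>t. random_walk i \<omega> s \<noteq> j} \<omega>) \<partial>random_maps E)"
    unfolding expected_hitting_time_def ennreal_hitting_time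
    by (intro nn_integral_cong suminf_cong) (simp add: indicator_def)
  also have "\<dots> = (\<Sum>t. \<integral>\<^sup>+\<omega>. indicator
      {\<omega> \<in> space (random_maps E). \<forall>s\<le>t. random_walk i \<omega> s \<noteq> j} \<omega> \<partial>random_maps E)"
    by (rule nn_integral_suminf) (rule borel_measurable_indicator[OF meas])
  also have "\<dots> = (\<Sum>t. ennreal (survival_prob E j t i))"
    by (intro suminf_cong) (simp add: meas survival_prob_def emeasure_eq_measure)
  finally show ?thesis .
qed

text \<open>At a maximum other than \<open>j\<close>, the differences to the neighbours are
  nonnegative with sum 0, so the neighbours attain the maximum as well; connectedness carries it to
  \<open>j\<close>.\<close>

lemma maximum_principle:
  fixes e :: "'a::finite \<Rightarrow> real"
  assumes conn: "\<And>u v. linked E u v" and j: "e j = 0"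
    and harm: "\<And>i. i \<noteq> j \<Longrightarrow> (\<Sum>k\<in>neighbors E i. e i - e k) = 0"
  shows "e i \<le> 0"
proof -
  have "Max (range e) \<in> range e" by (rule Max_in) auto
  then obtain m where m: "Max (range e) = e m" by (rule imageE)
  have le: "e k \<le> e m" for k unfolding m[symmetric] by (rule Max_ge) auto
  have "linked E j m" by (rule conn)
  \<comment> \<open>The goal is doubled to match the induction predicate at \<open>j\<close>; its
    second disjunct takes over if the walk meets \<open>j\<close> early.\<close>
  then have "e j = e m \<or> e j = e m"
  proof (induction rule: linked_induct[where P = "\<lambda>x. e x = e m \<or> e j = e m"])
    case (step x y)
    show ?case
    proof (cases "e j = e m")
      case False
      then have y: "e y = e m" "y \<noteq> j" using step(3) by auto
      have "x \<in> neighbors E y" using step(1) by (simp add: neighbors_def insert_commute)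
      moreover have "\<forall>k\<in>neighbors E y. e y - e k = 0"
        using harm[OF y(2)] le y(1) by (subst (asm) sum_nonneg_eq_0_iff) auto
      ultimately show ?thesis using y(1) by auto
    qed simp
  qed simp
  then show ?thesis using le[of i] j by simp
qed

text \<open>A nonnegative solution \<open>h\<close> dominates the partial sums of the tail
  probabilities, so their series converges. The limit solves the same equations, and the maximum
  principle, applied to the difference with both signs, gives equality.\<close>

lemma expected_hitting_time_eq_potential:
  fixes h :: "'a::finite \<Rightarrow> real"
  assumes conn: "\<And>u v. linked E u v" and ne: "\<And>v. neighbors E v \<noteq> {}"
    and h: "\<And>i. h i \<ge> 0" "h j = 0"
    and harm: "\<And>i. i \<noteq> j \<Longrightarrow> (\<Sum>k\<in>neighbors E i. h i - h k) = real (vdegree E i)"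
  shows "expected_hitting_time E i j = ennreal (h i)"
proof -
  have d: "real (vdegree E v) > 0" for v
    using ne by (simp add: vdegree_def card_gt_0_iff)
  have h_step: "h i = 1 + (\<Sum>k\<in>neighbors E i. h k) / real (vdegree E i)" if "i \<noteq> j" for i
  proof -
    have "real (vdegree E i) * h i - (\<Sum>k\<in>neighbors E i. h k) = real (vdegree E i)"
      using harm[OF that] by (simp add: sum_subtractf vdegree_def)
    then show ?thesis using d[of i] by (simp add: field_simps)
  qed
  \<comment> \<open>This is the expectation of the hitting time truncated at
    \<open>t\<close>.\<close>
  define S where "S t i = (\<Sum>s<t. survival_prob E j s i)" for t i
  have S_Suc: "S (Suc t) i = of_bool (i \<noteq> j) * (1 + (\<Sum>k\<in>neighbors E i. S t k) / real (vdegree E i))" for t i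
  proof -
    have "(\<Sum>s<t. survival_prob E j (Suc s) i) = of_bool (i \<noteq> j) *
        ((\<Sum>s<t. \<Sum>k\<in>neighbors E i. survival_prob E j s k) / real (vdegree E i))"
      unfolding survival_prob_Suc[OF ne] sum_distrib_left sum_divide_distrib ..
    also have "(\<Sum>s<t. \<Sum>k\<in>neighbors E i. survival_prob E j s k) = (\<Sum>k\<in>neighbors E i. S t k)"
      unfolding S_def by (rule sum.swap)
    finally show ?thesis
      unfolding S_def[of "Suc t"] sum.lessThan_Suc_shift survival_prob_0 by (simp add: distrib_left)
  qed
  have S_le: "S t i \<le> h i" for t i
  proof (induction t arbitrary: i)
    case 0
    then show ?case using h by (simp add: S_def)
  next
    case (Suc t)
    show ?case
    proof (cases "i = j")
      case False
      have "(\<Sum>k\<in>neighbors E i. S t k) / real (vdegree E i) \<le> (\<Sum>k\<in>neighbors E i. h k) / real (vdegree E i)"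
        using d[of i] by (intro divide_right_mono sum_mono Suc) auto
      then show ?thesis using False h_step[OF False] by (simp add: S_Suc)
    qed (use h in \<open>simp add: S_Suc\<close>)
  qed
  have summ: "summable (\<lambda>t. survival_prob E j t i)" for i
    using S_le[of _ i] unfolding S_def
    by (intro summableI_nonneg_bounded[where x = "h i"] survival_prob_nonneg) auto
  define s where "s i = (\<Sum>t. survival_prob E j t i)" for i
  have S_lim: "(\<lambda>t. S t i) \<longlonglongrightarrow> s i" for i
    using summable_LIMSEQ[OF summ] by (simp add: S_def s_def)
  have s_step: "s i = of_bool (i \<noteq> j) * (1 + (\<Sum>k\<in>neighbors E i. s k) / real (vdegree E i))" for i
  proof (rule LIMSEQ_unique)
    show "(\<lambda>t. S (Suc t) i) \<longlonglongrightarrow> s i" using S_lim by (rule LIMSEQ_Suc)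
    show "(\<lambda>t. S (Suc t) i) \<longlonglongrightarrow> of_bool (i \<noteq> j) * (1 + (\<Sum>k\<in>neighbors E i. s k) / real (vdegree E i))"
      unfolding S_Suc using d[of i] by (intro tendsto_intros S_lim) auto
  qed
  have s_harm: "(\<Sum>k\<in>neighbors E i. s i - s k) = real (vdegree E i)" if "i \<noteq> j" for i
  proof -
    have "s i = 1 + (\<Sum>k\<in>neighbors E i. s k) / real (vdegree E i)" using s_step[of i] that by simp
    then have "real (vdegree E i) * s i = real (vdegree E i) + (\<Sum>k\<in>neighbors E i. s k)"
      using d[of i] by (simp add: field_simps)
    then show ?thesis by (simp add: sum_subtractf vdegree_def)
  qed
  have sj: "s j = 0" using s_step[of j] by simp
  have "s i - h i \<le> 0"
  proof (rule maximum_principle[OF conn, of "\<lambda>i. s i - h i" j])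
    fix i assume "i \<noteq> j"
    then show "(\<Sum>k\<in>neighbors E i. s i - h i - (s k - h k)) = 0"
      using s_harm[of i] harm[of i] by (simp add: sum_subtractf right_diff_distrib)
  qed (simp add: sj h)
  moreover have "h i - s i \<le> 0"
  proof (rule maximum_principle[OF conn, of "\<lambda>i. h i - s i" j])
    fix i assume "i \<noteq> j"
    then show "(\<Sum>k\<in>neighbors E i. h i - s i - (h k - s k)) = 0"
      using s_harm[of i] harm[of i] by (simp add: sum_subtractf right_diff_distrib)
  qed (simp add: sj h)
  ultimately have "s i = h i" by simp
  then show ?thesis
    unfolding expected_hitting_time_eq_suminf
    using suminf_ennreal2[OF survival_prob_nonneg summ] by (simp add: s_def)
qed

section \<open>The Kemeny constant as a forest weight\<close>

lemma sum_vdegree: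
  assumes E: "simple_graph E"
  shows "(\<Sum>v\<in>UNIV. real (vdegree E v)) = 2 * real (card E)"
proof -
  have "(\<Sum>v\<in>UNIV. vdegree E v) = card (SIGMA v:UNIV. neighbors E v)"
    by (simp add: vdegree_def)
  also have "(SIGMA v:UNIV. neighbors E v) = (\<Union>e\<in>E. {x. {fst x, snd x} = e})"
    by (auto simp: neighbors_def)
  also have "card \<dots> = (\<Sum>e\<in>E. card {x. {fst x, snd x} = e})"
    by (rule card_UN_disjoint) auto
  also have "\<dots> = (\<Sum>e\<in>E. 2)"
  proof (rule sum.cong)
    fix e assume "e \<in> E"
    then obtain a b where ab: "e = {a, b}" "a \<noteq> b"
      using E by (auto simp: simple_graph_def card_2_iff)
    then have "{x. {fst x, snd x} = e} = {(a, b), (b, a)}" by (auto simp: doubleton_eq_iff)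
    then show "card {x. {fst x, snd x} = e} = 2" using \<open>a \<noteq> b\<close> by simp
  qed simp
  finally have "(\<Sum>v\<in>UNIV. vdegree E v) = 2 * card E" by simp
  then show ?thesis by (metis of_nat_mult of_nat_numeral of_nat_sum)
qed

lemma connected_graph_iff_linked: "connected_graph E \<longleftrightarrow> (\<forall>u v. linked E u v)"
  by (simp add: connected_graph_def linked_def)

lemma connected_neighbors_nonempty:
  fixes E :: "'a::finite set set"
  assumes "connected_graph E" "CARD('a) \<ge> 2"
  shows "neighbors E v \<noteq> {}"
proof
  assume nb: "neighbors E v = {}"
  have "card {v} < card (UNIV :: 'a set)" using assms(2) by simp
  then have "UNIV \<noteq> {v}" by (metis less_irrefl)
  then obtain w where "w \<noteq> v" by auto
  have "linked E v w" using assms(1) by (simp add: connected_graph_iff_linked)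
  then have "v = v \<longrightarrow> v = w"
  proof (induction rule: linked_induct[where P = "\<lambda>x. x = v \<longrightarrow> x = w"])
    case (step x y)
    then show ?case using nb by (auto simp: neighbors_def)
  qed auto
  then show False using \<open>w \<noteq> v\<close> by simp
qed

text \<open>The sum of hitting times has the same value for every start vertex, so the description
  operator in \<open>kemeny_constant\<close> picks that value.\<close>

lemma kemeny_constant_eq_forest_weight:
  fixes E :: "'a::finite set set"
  assumes E: "simple_graph E" "connected_graph E" and n: "CARD('a) \<ge> 2" and ne: "spanning_trees E \<noteq> {}"
  shows "kemeny_constant E = forest_weight E r / (2 * real (card E) * real (card (spanning_trees E)))"
proof -
  have H: "enn2real (expected_hitting_time E i j) = hitting_potential E j i" for i j
  proof -
    have "expected_hitting_time E i j = ennreal (hitting_potential E j i)"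
      using E(2) connected_neighbors_nonempty[OF E(2) n] hitting_potential_harmonic[OF E(1) ne]
      by (intro expected_hitting_time_eq_potential hitting_potential_nonneg)
         (auto simp: connected_graph_iff_linked)
    then show ?thesis by (simp add: hitting_potential_nonneg)
  qed
  have "(\<Sum>j\<in>UNIV. real (vdegree E j) / (2 * real (card E)) * enn2real (expected_hitting_time E i j)) =
      forest_weight E r / (2 * real (card E) * real (card (spanning_trees E)))" for i
  proof -
    have "(\<Sum>j\<in>UNIV. real (vdegree E j) / (2 * real (card E)) * enn2real (expected_hitting_time E i j)) =
        (\<Sum>j\<in>UNIV. real (vdegree E j) * hitting_potential E j i) / (2 * real (card E))"
      by (simp add: H sum_divide_distrib)
    also have "\<dots> = forest_weight E r / (2 * real (card E) * real (card (spanning_trees E)))"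
      unfolding sum_degree_hitting_potential[OF ne] forest_weight_root_independent[of E i r]
      by simp
    finally show ?thesis .
  qed
  then show ?thesis unfolding kemeny_constant_def by (intro the_equality) auto
qed

subsection \<open>Bounds on the Kemeny constant and on the estimator\<close>

lemma sum_neighbors_swap:
  fixes g :: "'a::finite \<Rightarrow> 'a \<Rightarrow> real"
  shows "(\<Sum>i\<in>UNIV. \<Sum>k\<in>neighbors E i. g i k) = (\<Sum>i\<in>UNIV. \<Sum>k\<in>neighbors E i. g k i)"
proof -
  have "(\<Sum>i\<in>UNIV. \<Sum>k\<in>neighbors E i. g i k) = (\<Sum>(i, k)\<in>Sigma UNIV (neighbors E). g i k)"
    by (rule sum.Sigma) auto
  also have "\<dots> = (\<Sum>(i, k)\<in>Sigma UNIV (neighbors E). g k i)"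
    by (rule sum.reindex_bij_witness[where i = prod.swap and j = prod.swap])
       (auto simp: neighbors_def insert_commute)
  also have "\<dots> = (\<Sum>i\<in>UNIV. \<Sum>k\<in>neighbors E i. g k i)"
    by (rule sum.Sigma[symmetric]) auto
  finally show ?thesis .
qed

text \<open>With \<open>h\<close> as a voltage, the current into \<open>j\<close> is the total
  degree minus \<open>vdegree E j\<close>. It is spread over \<open>vdegree E j\<close> edges, so
  Cauchy-Schwarz bounds the energy of these edges from below, and the full Dirichlet energy is at
  least as large.\<close>

lemma potential_sum_ge:
  fixes h :: "'a::finite \<Rightarrow> real"
  assumes h: "h j = 0"
    and harm: "\<And>i. i \<noteq> j \<Longrightarrow> (\<Sum>k\<in>neighbors E i. h i - h k) = real (vdegree E i)"
  shows "((\<Sum>i\<in>UNIV. real (vdegree E i)) - real (vdegree E j))\<^sup>2 \<le>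
    real (vdegree E j) * (\<Sum>i\<in>UNIV. real (vdegree E i) * h i)"
proof -
  let ?L = "\<lambda>i. \<Sum>k\<in>neighbors E i. h i - h k"
  \<comment> \<open>All differences cancel in pairs over the whole graph, so what leaves the other
    vertices arrives at \<open>j\<close>.\<close>
  have flow: "(\<Sum>k\<in>neighbors E j. h k) = (\<Sum>i\<in>UNIV. real (vdegree E i)) - real (vdegree E j)"
  proof -
    have "(\<Sum>i\<in>UNIV. ?L i) = 0"
      using sum_neighbors_swap[of "\<lambda>i k. h i" E] by (simp add: sum_subtractf)
    moreover have "(\<Sum>i\<in>UNIV. ?L i) = ?L j + (\<Sum>i\<in>UNIV - {j}. ?L i)"
      by (rule sum.remove) auto
    moreover have "(\<Sum>i\<in>UNIV - {j}. ?L i) = (\<Sum>i\<in>UNIV - {j}. real (vdegree E i))"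
      using harm by (intro sum.cong) auto
    moreover have "(\<Sum>i\<in>UNIV. real (vdegree E i)) =
        real (vdegree E j) + (\<Sum>i\<in>UNIV - {j}. real (vdegree E i))"
      by (rule sum.remove) auto
    ultimately show ?thesis using h by (simp add: sum_negf)
  qed
  \<comment> \<open>Green's identity: the term at \<open>j\<close> vanishes because
    \<open>h j = 0\<close>, and ordered pairs count each edge twice.\<close>
  have energy: "2 * (\<Sum>i\<in>UNIV. real (vdegree E i) * h i) =
      (\<Sum>i\<in>UNIV. \<Sum>k\<in>neighbors E i. (h i - h k)\<^sup>2)"
  proof -
    have "(\<Sum>i\<in>UNIV. real (vdegree E i) * h i) = (\<Sum>i\<in>UNIV. \<Sum>k\<in>neighbors E i. h i * (h i - h k))"
      unfolding sum_distrib_left[symmetric]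
    proof (rule sum.cong)
      fix i show "real (vdegree E i) * h i = h i * ?L i"
        using harm[of i] h by (cases "i = j") auto
    qed simp
    moreover from this have "(\<Sum>i\<in>UNIV. real (vdegree E i) * h i) = (\<Sum>i\<in>UNIV. \<Sum>k\<in>neighbors E i. h k * (h k - h i))"
      using sum_neighbors_swap[of "\<lambda>i k. h i * (h i - h k)" E] by simp
    ultimately have "2 * (\<Sum>i\<in>UNIV. real (vdegree E i) * h i) =
        (\<Sum>i\<in>UNIV. \<Sum>k\<in>neighbors E i. h i * (h i - h k) + h k * (h k - h i))"
      unfolding sum.distrib by linarith
    then show ?thesis by (simp add: power2_eq_square algebra_simps)
  qed
  \<comment> \<open>Only the edges at \<open>j\<close> are kept, each in both directions.\<close>
  have "2 * (\<Sum>k\<in>neighbors E j. (h k)\<^sup>2) \<le> (\<Sum>i\<in>UNIV. \<Sum>k\<in>neighbors E i. (h i - h k)\<^sup>2)"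
  proof -
    have eq: "(\<Sum>k\<in>neighbors E j. (h k)\<^sup>2) = (\<Sum>i\<in>UNIV. \<Sum>k\<in>neighbors E i. of_bool (i = j) * (h k)\<^sup>2)"
    proof -
      have "(\<Sum>i\<in>UNIV. \<Sum>k\<in>neighbors E i. of_bool (i = j) * (h k)\<^sup>2) =
          (\<Sum>i\<in>UNIV. if i = j then \<Sum>k\<in>neighbors E i. (h k)\<^sup>2 else 0)"
        by (rule sum.cong) auto
      then show ?thesis by simp
    qed
    have "2 * (\<Sum>k\<in>neighbors E j. (h k)\<^sup>2) =
        (\<Sum>i\<in>UNIV. \<Sum>k\<in>neighbors E i. of_bool (i = j) * (h k)\<^sup>2 + of_bool (k = j) * (h i)\<^sup>2)"
      unfolding sum.distrib using eq sum_neighbors_swap[of "\<lambda>i k. of_bool (i = j) * (h k)\<^sup>2" E] by linarith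
    also have "\<dots> \<le> (\<Sum>i\<in>UNIV. \<Sum>k\<in>neighbors E i. (h i - h k)\<^sup>2)"
      using h by (intro sum_mono) (auto simp: of_bool_def)
    finally show ?thesis .
  qed
  then have "(\<Sum>k\<in>neighbors E j. (h k)\<^sup>2) \<le> (\<Sum>i\<in>UNIV. real (vdegree E i) * h i)"
    using energy by linarith
  then have "real (vdegree E j) * (\<Sum>k\<in>neighbors E j. (h k)\<^sup>2) \<le>
      real (vdegree E j) * (\<Sum>i\<in>UNIV. real (vdegree E i) * h i)"
    by (rule mult_left_mono) simp
  moreover have "(\<Sum>k\<in>neighbors E j. h k)\<^sup>2 \<le> real (vdegree E j) * (\<Sum>k\<in>neighbors E j. (h k)\<^sup>2)"
    using sum_squared_le_sum_of_squares[of h "neighbors E j"] by (simp add: vdegree_def mult.commute)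
  ultimately show ?thesis unfolding flow by linarith
qed

text \<open>The bounds for the single targets \<open>j\<close> are added. On the left Cauchy-Schwarz
  applies once more, to \<open>D - vdegree E j\<close>; on the right every start vertex contributes
  the same value \<open>W\<close>.\<close>

lemma forest_weight_ge:
  fixes E :: "'a::finite set set"
  assumes E: "simple_graph E" and ne: "spanning_trees E \<noteq> {}" and m: "card E > 0"
  shows "2 * real (card E) * (real CARD('a) - 1)\<^sup>2 / real CARD('a) \<le>
    forest_weight E r / real (card (spanning_trees E))"
proof -
  define D where "D = 2 * real (card E)"
  define W where "W = forest_weight E r / real (card (spanning_trees E))"
  let ?d = "\<lambda>i. real (vdegree E i)" and ?n = "real CARD('a)"
  have D: "(\<Sum>i\<in>UNIV. ?d i) = D" "D > 0" using sum_vdegree[OF E] m by (simp_all add: D_def)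
  have n: "?n > 0" by simp
  have "(\<Sum>j\<in>UNIV. D - ?d j)\<^sup>2 \<le> (\<Sum>j\<in>UNIV. (D - ?d j)\<^sup>2) * ?n"
    using sum_squared_le_sum_of_squares[of "\<lambda>j. D - ?d j" UNIV] by simp
  moreover have "(\<Sum>j\<in>UNIV. D - ?d j) = D * (?n - 1)"
    by (simp add: sum_subtractf D algebra_simps)
  ultimately have "D\<^sup>2 * (?n - 1)\<^sup>2 \<le> (\<Sum>j\<in>UNIV. (D - ?d j)\<^sup>2) * ?n"
    by (simp add: power_mult_distrib)
  moreover have "(\<Sum>j\<in>UNIV. (D - ?d j)\<^sup>2) \<le>
      (\<Sum>j\<in>UNIV. ?d j * (\<Sum>i\<in>UNIV. ?d i * hitting_potential E j i))"
  proof (rule sum_mono)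
    fix j
    show "(D - ?d j)\<^sup>2 \<le> ?d j * (\<Sum>i\<in>UNIV. ?d i * hitting_potential E j i)"
      using potential_sum_ge[OF hitting_potential_self hitting_potential_harmonic[OF E ne]]
      unfolding D(1) by blast
  qed
  moreover have "(\<Sum>j\<in>UNIV. ?d j * (\<Sum>i\<in>UNIV. ?d i * hitting_potential E j i)) = D * W"
  proof -
    have "(\<Sum>j\<in>UNIV. ?d j * (\<Sum>i\<in>UNIV. ?d i * hitting_potential E j i)) =
        (\<Sum>i\<in>UNIV. ?d i * (\<Sum>j\<in>UNIV. ?d j * hitting_potential E j i))"
      unfolding sum_distrib_left by (subst sum.swap) (simp only: mult_ac)
    also have "\<dots> = (\<Sum>i\<in>UNIV. ?d i * W)"
    proof (rule sum.cong)
      fix i show "?d i * (\<Sum>j\<in>UNIV. ?d j * hitting_potential E j i) = ?d i * W"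
        unfolding sum_degree_hitting_potential[OF ne] W_def
        by (simp add: forest_weight_root_independent[of E i r])
    qed simp
    finally show ?thesis by (simp add: sum_distrib_right[symmetric] D)
  qed
  ultimately have "D\<^sup>2 * (?n - 1)\<^sup>2 \<le> D * W * ?n"
    using n by (smt (verit) mult_right_mono)
  then have "D * (D * (?n - 1)\<^sup>2) \<le> D * (W * ?n)"
    by (simp add: power2_eq_square mult_ac)
  then have "D * (?n - 1)\<^sup>2 \<le> W * ?n"
    using D(2) by (simp only: mult_le_cancel_left_pos)
  then show ?thesis
    unfolding W_def[symmetric] D_def[symmetric] using n by (simp add: divide_le_eq)
qed

section \<open>Distances, the diameter and breadth-first search levels\<close>

lemma graph_diameter_eq_Max: "graph_diameter E = Max ((\<lambda>(u, v). graph_dist E u v) ` UNIV)"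
  unfolding graph_diameter_def by (rule arg_cong[where f = Max]) auto

lemma graph_dist_le_diameter: "graph_dist E u v \<le> graph_diameter E"
  unfolding graph_diameter_eq_Max by (rule Max_ge) auto

lemma graph_dist_walk:
  assumes "linked E u v"
  obtains p where "gwalk E u p v" "length p = Suc (graph_dist E u v)"
proof -
  obtain q where q: "gwalk E u q v" using assms by (auto simp: linked_def)
  then obtain k where "length q = Suc k" by (cases q) (auto simp: gwalk_def)
  then have "\<exists>k p. gwalk E u p v \<and> length p = Suc k" using q by blast
  from LeastI_ex[OF this] show ?thesis using that unfolding graph_dist_def by blast
qed

lemma graph_dist_less_card:
  fixes u v :: "'a::finite"
  assumes "linked E u v"
  shows "graph_dist E u v < CARD('a)"
proof -
  obtain p where p: "gpath E u p v" using linked_imp_gpath[OF assms] by blast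
  then obtain k where k: "length p = Suc k" by (cases p) (auto simp: gpath_def gwalk_def)
  have "graph_dist E u v \<le> k"
    unfolding graph_dist_def using p k by (intro Least_le) (auto simp: gpath_def)
  moreover have "length p \<le> CARD('a)"
    using p by (metis gpath_def card_mono distinct_card finite subset_UNIV)
  ultimately show ?thesis using k by simp
qed

text \<open>The strict inequality later yields one of the two factors
  \<open>(n - 1) / n\<close>.\<close>

lemma graph_diameter_less_card:
  fixes E :: "'a::finite set set"
  assumes "connected_graph E"
  shows "graph_diameter E < CARD('a)"
proof -
  have "Max ((\<lambda>(u, v). graph_dist E u v) ` UNIV) \<in> (\<lambda>(u, v). graph_dist E u v) ` UNIV"
    by (rule Max_in) auto
  then show ?thesis
    using assms graph_dist_less_card[where 'a = 'a] unfolding graph_diameter_eq_Max connected_graph_iff_linked by auto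
qed

lemma graph_diameter_pos:
  fixes E :: "'a::finite set set"
  assumes "connected_graph E" and "CARD('a) \<ge> 2"
  shows "graph_diameter E > 0"
proof -
  define v where "v = (undefined :: 'a)"
  have "card {v} < CARD('a)" using assms(2) by simp
  then have "UNIV \<noteq> {v}" by (metis less_irrefl)
  then obtain w where w: "w \<noteq> v" by auto
  have "linked E v w" using assms(1) by (simp add: connected_graph_iff_linked)
  then obtain p where p: "gwalk E v p w" "length p = Suc (graph_dist E v w)"
    by (rule graph_dist_walk)
  have "graph_dist E v w \<noteq> 0"
  proof
    assume "graph_dist E v w = 0"
    then obtain x where "p = [x]" using p(2) by (auto simp: length_Suc_conv)
    then show False using p(1) w by (auto simp: gwalk_def)
  qed
  then show ?thesis using graph_dist_le_diameter[of E v w] by simp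
qed

text \<open>The loop invariant of breadth-first search. Vertices in \<open>D - set Q\<close> are
  fully scanned; the queue is ordered by level, spans at most two consecutive levels and holds no
  level below a scanned one.\<close>

definition bfs_levels ::
  "'a::finite set set \<Rightarrow> 'a \<Rightarrow> 'a list \<Rightarrow> 'a set \<Rightarrow> 'a set set \<Rightarrow> ('a \<Rightarrow> nat) \<Rightarrow> bool" where
  "bfs_levels E r Q D \<tau> lv \<longleftrightarrow> r \<in> D \<and> lv r = 0 \<and> set Q \<subseteq> D \<and>
    (\<forall>v\<in>D. \<exists>p. gwalk \<tau> v p r \<and> length p = Suc (lv v)) \<and>
    (\<forall>x\<in>D - set Q. \<forall>y\<in>neighbors E x. y \<in> D \<and> lv y \<le> Suc (lv x)) \<and>
    sorted (map lv Q) \<and> (\<forall>q\<in>set Q. lv q \<le> Suc (lv (hd Q))) \<and>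
    (\<forall>x\<in>D - set Q. \<forall>q\<in>set Q. lv x \<le> lv q)"

lemma bfs_run_levels:
  assumes "bfs_run E r Q D \<tau>"
  shows "\<exists>lv. bfs_levels E r Q D \<tau> lv"
  using assms
proof induction
  case start
  show ?case by (rule exI[of _ "\<lambda>_. 0"]) (auto simp: bfs_levels_def gwalk_def intro!: exI[of _ "[r]"])
next
  case (discover u Q D \<tau> v)
  obtain lv where "bfs_levels E r (u # Q) D \<tau> lv" using discover.IH by blast
  then have l: "r \<in> D" "lv r = 0" "set (u # Q) \<subseteq> D"
      "\<forall>v\<in>D. \<exists>p. gwalk \<tau> v p r \<and> length p = Suc (lv v)"
      "\<forall>x\<in>D - set (u # Q). \<forall>y\<in>neighbors E x. y \<in> D \<and> lv y \<le> Suc (lv x)"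
      "sorted (map lv (u # Q))" "\<forall>q\<in>set (u # Q). lv q \<le> Suc (lv u)"
      "\<forall>x\<in>D - set (u # Q). \<forall>q\<in>set (u # Q). lv x \<le> lv q"
    unfolding bfs_levels_def list.sel by blast+
  \<comment> \<open>The new vertex lies one level beyond its parent \<open>u\<close>, the largest
    level that the queue may hold.\<close>
  define k where "k = lv(v := Suc (lv u))"
  have k: "k x = lv x" if "x \<in> D" for x
    using that discover.hyps(3) by (auto simp: k_def)
  have v: "v \<notin> set (u # Q)" "u \<in> D" using l(3) discover.hyps(3) by auto
  have mapk: "map k (u # Q) = map lv (u # Q)"
    using l(3) k by (intro map_cong) auto
  have walks: "\<exists>p. gwalk (insert {u, v} \<tau>) x p r \<and> length p = Suc (k x)" if x: "x \<in> insert v D" for x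
  proof (cases "x = v")
    case True
    obtain p where p: "gwalk \<tau> u p r" "length p = Suc (lv u)" using l(4) v(2) by blast
    have "gwalk (insert {u, v} \<tau>) u p r" by (rule gwalk_mono[OF p(1)]) auto
    then have "gwalk (insert {u, v} \<tau>) v (v # p) r"
      by (auto simp: gwalk_Cons insert_commute) (auto simp: gwalk_def insert_commute)
    then show ?thesis using True p(2) by (intro exI[of _ "v # p"]) (simp add: k_def)
  next
    case False
    then have xD: "x \<in> D" using x by simp
    then obtain p where p: "gwalk \<tau> x p r" "length p = Suc (lv x)" using l(4) by blast
    have "gwalk (insert {u, v} \<tau>) x p r" by (rule gwalk_mono[OF p(1)]) auto
    then show ?thesis using p(2) k[OF xD] by auto
  qed
  have processed: "y \<in> D \<and> k y \<le> Suc (k x)"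
    if "x \<in> insert v D - set (u # Q @ [v])" "y \<in> neighbors E x" for x y
  proof -
    have "x \<in> D - set (u # Q)" using that(1) by auto
    then have "x \<in> D" "y \<in> D" "lv y \<le> Suc (lv x)" using l(5) that(2) by blast+
    then show ?thesis using k by simp
  qed
  have srt: "sorted (map k (u # Q @ [v]))"
  proof -
    have "map k (u # Q @ [v]) = map lv (u # Q) @ [Suc (lv u)]" using mapk by (simp add: k_def)
    moreover have "sorted (map lv (u # Q) @ [Suc (lv u)])" unfolding sorted_append using l(6,7) by auto
    ultimately show ?thesis by metis
  qed
  have hd_le: "\<forall>q\<in>set (u # Q @ [v]). k q \<le> Suc (k u)"
  proof
    fix q assume "q \<in> set (u # Q @ [v])"
    then consider "q \<in> set (u # Q)" | "q = v" by auto
    then show "k q \<le> Suc (k u)"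
      using l(3,7) k[OF v(2)] k[of q] by cases (auto simp: k_def)
  qed
  have old_le: "\<forall>x\<in>insert v D - set (u # Q @ [v]). \<forall>q\<in>set (u # Q @ [v]). k x \<le> k q"
  proof (intro ballI)
    fix x q assume x: "x \<in> insert v D - set (u # Q @ [v])" and q: "q \<in> set (u # Q @ [v])"
    have x': "x \<in> D - set (u # Q)" using x by auto
    then have "lv x \<le> lv u" using l(8) by simp
    moreover have "lv x \<le> lv q" if "q \<in> set (u # Q)" using l(8) x' that by blast
    moreover have "k x = lv x" using x' k by blast
    moreover have "k q = lv q" if "q \<in> set (u # Q)" using l(3) k that by blast
    ultimately show "k x \<le> k q" using q by (cases "q = v") (auto simp: k_def)
  qed
  have kr: "k r = 0" using l(1,2) k by simp
  have "bfs_levels E r (u # Q @ [v]) (insert v D) (insert {u, v} \<tau>) k"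
  proof (unfold bfs_levels_def list.sel, intro conjI)
    show "r \<in> insert v D" "set (u # Q @ [v]) \<subseteq> insert v D" using l(1,3) by auto
    show "\<forall>x\<in>insert v D. \<exists>p. gwalk (insert {u, v} \<tau>) x p r \<and> length p = Suc (k x)"
      using walks by blast
    show "\<forall>x\<in>insert v D - set (u # Q @ [v]). \<forall>y\<in>neighbors E x. y \<in> insert v D \<and> k y \<le> Suc (k x)"
      using processed by blast
  qed (rule kr srt hd_le old_le)+
  then show ?case by blast
next
  case (dequeue u Q D \<tau>)
  obtain lv where "bfs_levels E r (u # Q) D \<tau> lv" using dequeue.IH by blast
  then have l: "r \<in> D" "lv r = 0" "set (u # Q) \<subseteq> D"
      "\<forall>v\<in>D. \<exists>p. gwalk \<tau> v p r \<and> length p = Suc (lv v)"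
      "\<forall>x\<in>D - set (u # Q). \<forall>y\<in>neighbors E x. y \<in> D \<and> lv y \<le> Suc (lv x)"
      "sorted (map lv (u # Q))" "\<forall>q\<in>set (u # Q). lv q \<le> Suc (lv u)"
      "\<forall>x\<in>D - set (u # Q). \<forall>q\<in>set (u # Q). lv x \<le> lv q"
    unfolding bfs_levels_def list.sel by blast+
  \<comment> \<open>Discovered vertices lie at most one level beyond \<open>u\<close>: queued ones
    by the span of the queue, scanned ones because their level is at most that of \<open>u\<close>.
    Hence \<open>u\<close> may join the scanned vertices.\<close>
  have u_le: "lv y \<le> Suc (lv u)" if "y \<in> D" for y
    using l(7,8) that by (cases "y \<in> set (u # Q)") (auto simp: le_SucI)
  have "\<forall>x\<in>D - set Q. \<forall>y\<in>neighbors E x. y \<in> D \<and> lv y \<le> Suc (lv x)"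
  proof (intro ballI)
    fix x y assume x: "x \<in> D - set Q" and y: "y \<in> neighbors E x"
    show "y \<in> D \<and> lv y \<le> Suc (lv x)"
    proof (cases "x = u")
      case True
      then show ?thesis using y u_le dequeue.hyps(2) by blast
    next
      case False
      then have "x \<in> D - set (u # Q)" using x by simp
      then show ?thesis using l(5) y by blast
    qed
  qed
  moreover have "\<forall>q\<in>set Q. lv q \<le> Suc (lv (hd Q))"
  proof
    fix q assume "q \<in> set Q"
    moreover from this have "hd Q \<in> set Q" by (cases Q) auto
    ultimately have "lv u \<le> lv (hd Q)" "lv q \<le> Suc (lv u)" using l(6,7) by auto
    then show "lv q \<le> Suc (lv (hd Q))" by simp
  qed
  moreover have "\<forall>x\<in>D - set Q. \<forall>q\<in>set Q. lv x \<le> lv q"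
    using l(6,8) by auto
  moreover have "sorted (map lv Q)" using l(6) by simp
  ultimately have "bfs_levels E r Q D \<tau> lv"
    using l(1-4) unfolding bfs_levels_def by simp
  then show ?case by blast
qed

text \<open>At the end of the search every discovered vertex is scanned, so levels rise by at most
  one along each edge of \<open>E\<close> and are bounded by the distance from \<open>r\<close>. The
  unique tree path is no longer than the walk realising the level.\<close>

lemma bfs_tree_path_length:
  assumes E: "simple_graph E" "connected_graph E" and bfs: "bfs_spanning_tree E r \<tau>\<^sub>0"
  shows "length (tree_path \<tau>\<^sub>0 u r) \<le> Suc (graph_diameter E)"
proof -
  have \<tau>0: "\<tau>\<^sub>0 \<in> spanning_trees E" using bfs by (simp add: bfs_spanning_tree_def)
  obtain D where "bfs_run E r [] D \<tau>\<^sub>0" using bfs by (auto simp: bfs_spanning_tree_def)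
  from bfs_run_levels[OF this] obtain lv where "bfs_levels E r [] D \<tau>\<^sub>0 lv" by blast
  then have l: "r \<in> D" "lv r = 0"
      "\<forall>v\<in>D. \<exists>p. gwalk \<tau>\<^sub>0 v p r \<and> length p = Suc (lv v)"
      "\<forall>x\<in>D. \<forall>y\<in>neighbors E x. y \<in> D \<and> lv y \<le> Suc (lv x)"
    by (simp_all add: bfs_levels_def)
  have level: "v \<in> D \<and> Suc (lv v) \<le> lv x + length p" if "gwalk E x p v" "x \<in> D" for x p v
    using that
  proof (induction p arbitrary: x)
    case Nil
    then show ?case by (simp add: gwalk_def)
  next
    case (Cons y p)
    show ?case
    proof (cases "p = []")
      case True
      then show ?thesis using Cons.prems by (auto simp: gwalk_Cons)
    next
      case False
      then have w: "{x, hd p} \<in> E" "gwalk E (hd p) p v" using Cons.prems by (auto simp: gwalk_Cons)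
      then have "hd p \<in> D" "lv (hd p) \<le> Suc (lv x)"
        using l(4) Cons.prems(2) by (auto simp: neighbors_def)
      then show ?thesis using Cons.IH[OF w(2)] by simp
    qed
  qed
  have "linked E r u" using E(2) by (simp add: connected_graph_iff_linked)
  then obtain p where p: "gwalk E r p u" "length p = Suc (graph_dist E r u)"
    by (rule graph_dist_walk)
  then have u: "u \<in> D" "lv u \<le> graph_dist E r u" using level[OF p(1) l(1)] l(2) by auto
  then obtain q where q: "gwalk \<tau>\<^sub>0 u q r" "length q = Suc (lv u)" using l(3) by blast
  obtain q' where q': "gpath \<tau>\<^sub>0 u q' r" "length q' \<le> length q"
    using gwalk_imp_gpath[OF q(1)] by blast
  have "all_bridges \<tau>\<^sub>0" using \<tau>0 spanning_trees_iff[OF E(1)] by blast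
  then have "tree_path \<tau>\<^sub>0 u r = q'"
    using gpath_tree_path[OF E(1) \<tau>0] q'(1) by (rule gpath_unique)
  then show ?thesis using q'(2) q(2) u(2) graph_dist_le_diameter[of E r u] by simp
qed

section \<open>The range of the statistic\<close>

lemma card_forests_along_le:
  "card (forests_along P u r \<tau>) \<le> length P - 1"
proof -
  have "forests_along P u r \<tau> \<subseteq> (\<lambda>k. \<tau> - {{P ! k, P ! Suc k}}) ` {..<length P - 1}"
    unfolding forests_along_def path_arcs_iff_nth by force
  then have "card (forests_along P u r \<tau>) \<le> card {..<length P - 1}"
    by (rule surj_card_le[rotated]) simp
  then show ?thesis by simp
qed

text \<open>The first and the last arc of a path from \<open>u\<close> to \<open>r\<close> cannot be traversed backwards by another
  such path.\<close>

lemma card_forests_against_le: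
  fixes P :: "'a::finite list"
  assumes P: "P \<noteq> []" "hd P = u" "last P = r" and q: "gpath \<tau> u (tree_path \<tau> u r) r"
  shows "card (forests_against P u r \<tau>) \<le> length P - 1 - 2"
proof -
  let ?q = "tree_path \<tau> u r"
  have q': "?q \<noteq> []" "?q ! 0 = u" "?q ! (length ?q - 1) = r" "distinct ?q"
    using q by (auto simp: gpath_def gwalk_def hd_conv_nth last_conv_nth)
  have "forests_against P u r \<tau> \<subseteq> (\<lambda>k. \<tau> - {{P ! k, P ! Suc k}}) ` {1..<length P - 2}"
  proof
    fix F assume "F \<in> forests_against P u r \<tau>"
    then obtain k l where k: "Suc k < length P" "F = \<tau> - {{P ! k, P ! Suc k}}"
      and l: "Suc l < length ?q" "?q ! l = P ! Suc k" "?q ! Suc l = P ! k"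
      unfolding forests_against_def path_arcs_iff_nth by force
    have "k \<noteq> 0"
    proof
      assume "k = 0"
      then have "?q ! Suc l = ?q ! 0" using l(3) P q'(2) by (simp add: hd_conv_nth)
      then show False using q'(1,4) l(1) nth_eq_iff_index_eq[OF q'(4), of "Suc l" 0] by simp
    qed
    moreover have "Suc k \<noteq> length P - 1"
    proof
      assume "Suc k = length P - 1"
      then have "?q ! l = ?q ! (length ?q - 1)" using l(2) P q'(3) by (simp add: last_conv_nth)
      then show False using q'(1) l(1) nth_eq_iff_index_eq[OF q'(4), of l "length ?q - 1"] by simp
    qed
    ultimately show "F \<in> (\<lambda>k. \<tau> - {{P ! k, P ! Suc k}}) ` {1..<length P - 2}"
      using k by (intro image_eqI[of _ _ k]) auto
  qed
  then have "card (forests_against P u r \<tau>) \<le> card {1..<length P - 2}"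
    by (rule surj_card_le[rotated]) simp
  then show ?thesis by simp
qed

text \<open>The deleted edge lies on the tree path from \<open>u\<close> to \<open>r\<close>, so the
  tree of \<open>r\<close> misses \<open>u\<close> and its degree.\<close>

lemma vol_root_tree_le:
  assumes E: "simple_graph E" and \<tau>: "\<tau> \<in> spanning_trees E"
    and F: "F \<in> forests_along P u r \<tau> \<union> forests_against P u r \<tau>"
  shows "real (vol E (tree_of F r)) \<le> 2 * real (card E) - real (vdegree E u)"
proof -
  obtain a b where Fab: "F = \<tau> - {{a, b}}" and arc: "(a, b) \<in> path_arcs (tree_path \<tau> u r)"
    using F unfolding forests_along_def forests_against_def by (auto simp: insert_commute)
  have ab: "{a, b} \<in> \<tau>" "linked F u a" "linked F b r"
    using arc path_arcs_tree_path_iff[OF E \<tau>] Fab by auto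
  have "\<not> linked F a b" using remove_edge_two_forest(2)[OF E \<tau> ab(1)] Fab by simp
  then have "\<not> linked F r u" using ab by (meson linked_sym linked_trans)
  then have "u \<notin> tree_of F r" by (simp add: tree_of_eq)
  then have "vol E (tree_of F r) \<le> vol E (UNIV - {u})"
    unfolding vol_def by (intro sum_mono2) auto
  then have "real (vol E (tree_of F r)) \<le> real (vol E (UNIV - {u}))" by simp
  also have "\<dots> = 2 * real (card E) - real (vdegree E u)"
    unfolding sum_vdegree[OF E, symmetric] vol_def of_nat_sum
    by (subst sum.remove[of UNIV u]) auto
  finally show ?thesis .
qed

text \<open>The upper bound drops the forests against the path, the lower bound those along it.
  Truncated subtraction is right at diameter 1, where no arc can be traversed backwards.\<close>

lemma tree_stat_bounds:
  fixes E :: "'a::finite set set" and r :: 'a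
  assumes E: "simple_graph E" "connected_graph E" and bfs: "bfs_spanning_tree E r \<tau>\<^sub>0"
    and \<tau>: "\<tau> \<in> spanning_trees E"
  defines "S \<equiv> \<Sum>u\<in>UNIV - {r}. real (vdegree E u) * (2 * real (card E) - real (vdegree E u))"
  shows "tree_stat E r \<tau>\<^sub>0 \<tau> \<le> real (graph_diameter E) * S"
    and "- (real (graph_diameter E - 2) * S) \<le> tree_stat E r \<tau>\<^sub>0 \<tau>"
proof -
  let ?\<Delta> = "graph_diameter E"
  let ?P = "\<lambda>u. tree_path \<tau>\<^sub>0 u r"
  let ?v = "\<lambda>F. real (vol E (tree_of F r))"
  let ?c = "\<lambda>u. 2 * real (card E) - real (vdegree E u)"
  have \<tau>0: "\<tau>\<^sub>0 \<in> spanning_trees E" using bfs by (simp add: bfs_spanning_tree_def)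
  have c: "?c u \<ge> 0" for u
    using sum_vdegree[OF E(1)] member_le_sum[of u UNIV "\<lambda>u. real (vdegree E u)"] by simp
  have P: "?P u \<noteq> []" "hd (?P u) = u" "last (?P u) = r" for u
    using gpath_tree_path[OF E(1) \<tau>0] by (auto simp: gpath_def gwalk_def)
  have along: "(\<Sum>F\<in>forests_along (?P u) u r \<tau>. ?v F) \<le> real ?\<Delta> * ?c u" for u
  proof -
    have "(\<Sum>F\<in>forests_along (?P u) u r \<tau>. ?v F) \<le> real (card (forests_along (?P u) u r \<tau>)) * ?c u"
      using vol_root_tree_le[OF E(1) \<tau>] by (intro sum_bounded_above) auto
    also have "card (forests_along (?P u) u r \<tau>) \<le> ?\<Delta>"
      using card_forests_along_le[of "?P u" u r \<tau>] bfs_tree_path_length[OF E bfs, of u] by simp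
    finally show ?thesis using c[of u] by (simp add: mult_right_mono)
  qed
  have against: "(\<Sum>F\<in>forests_against (?P u) u r \<tau>. ?v F) \<le> real (?\<Delta> - 2) * ?c u" for u
  proof -
    have "(\<Sum>F\<in>forests_against (?P u) u r \<tau>. ?v F) \<le> real (card (forests_against (?P u) u r \<tau>)) * ?c u"
      using vol_root_tree_le[OF E(1) \<tau>] by (intro sum_bounded_above) auto
    also have "card (forests_against (?P u) u r \<tau>) \<le> ?\<Delta> - 2"
      using card_forests_against_le[OF P gpath_tree_path[OF E(1) \<tau>], of u] bfs_tree_path_length[OF E bfs, of u]
      by simp
    finally show ?thesis using c[of u] by (simp add: mult_right_mono)
  qed
  have nonneg: "(\<Sum>F\<in>forests_along (?P u) u r \<tau>. ?v F) \<ge> 0" "(\<Sum>F\<in>forests_against (?P u) u r \<tau>. ?v F) \<ge> 0" for u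
    by (auto intro!: sum_nonneg)
  have "tree_stat E r \<tau>\<^sub>0 \<tau> \<le> (\<Sum>u\<in>UNIV - {r}. real (vdegree E u) * (real ?\<Delta> * ?c u))"
    unfolding tree_stat_def
  proof (intro sum_mono mult_left_mono)
    fix u show "(\<Sum>F\<in>forests_along (?P u) u r \<tau>. ?v F) - (\<Sum>F\<in>forests_against (?P u) u r \<tau>. ?v F) \<le> real ?\<Delta> * ?c u"
      using along[of u] nonneg(2)[of u] by linarith
  qed simp
  then show "tree_stat E r \<tau>\<^sub>0 \<tau> \<le> real ?\<Delta> * S"
    unfolding S_def sum_distrib_left by (simp only: mult_ac)
  have "(\<Sum>u\<in>UNIV - {r}. real (vdegree E u) * (- (real (?\<Delta> - 2) * ?c u))) \<le> tree_stat E r \<tau>\<^sub>0 \<tau>"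
    unfolding tree_stat_def
  proof (intro sum_mono mult_left_mono)
    fix u show "- (real (?\<Delta> - 2) * ?c u) \<le> (\<Sum>F\<in>forests_along (?P u) u r \<tau>. ?v F) - (\<Sum>F\<in>forests_against (?P u) u r \<tau>. ?v F)"
      using against[of u] nonneg(1)[of u] by linarith
  qed simp
  then show "- (real (?\<Delta> - 2) * S) \<le> tree_stat E r \<tau>\<^sub>0 \<tau>"
    unfolding S_def sum_distrib_left sum_negf[symmetric] mult_minus_right[symmetric] by (simp only: mult_ac)
qed

text \<open>One factor \<open>(n - 1) / n\<close> comes from Cauchy-Schwarz for the degrees in
  \<open>S\<close>, the other from \<open>2 * \<Delta> - 2 \<le> 2 * \<Delta> * (n - 1) / n\<close>,
  which holds as \<open>\<Delta> < n\<close>.\<close>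

lemma tree_stat_range_le:
  fixes E :: "'a::finite set set" and r :: 'a
  assumes E: "simple_graph E" "connected_graph E" and n: "CARD('a) \<ge> 2"
  defines "S \<equiv> \<Sum>u\<in>UNIV - {r}. real (vdegree E u) * (2 * real (card E) - real (vdegree E u))"
  shows "real (graph_diameter E) * S + real (graph_diameter E - 2) * S \<le>
    2 * real (graph_diameter E) * (2 * real (card E))\<^sup>2 * ((real CARD('a) - 1) / real CARD('a))\<^sup>2"
proof -
  define D where "D = 2 * real (card E)"
  define \<Delta> where "\<Delta> = graph_diameter E"
  define x where "x = (real CARD('a) - 1) / real CARD('a)"
  let ?d = "\<lambda>i. real (vdegree E i)" and ?n = "real CARD('a)"
  have D: "(\<Sum>i\<in>UNIV. ?d i) = D" "D \<ge> 0" using sum_vdegree[OF E(1)] by (simp_all add: D_def)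
  have d_le: "?d u \<le> D" for u
    using D(1) member_le_sum[of u UNIV ?d] by simp
  have x: "0 \<le> x" "x = 1 - 1 / ?n" using n by (auto simp: x_def field_simps)
  have S0: "S \<ge> 0" unfolding S_def D_def[symmetric] using d_le by (intro sum_nonneg) auto
  have "S \<le> (\<Sum>u\<in>UNIV. ?d u * (D - ?d u))"
    unfolding S_def D_def[symmetric] using d_le by (intro sum_mono2) auto
  also have "\<dots> = D\<^sup>2 - (\<Sum>u\<in>UNIV. (?d u)\<^sup>2)"
    by (simp add: right_diff_distrib sum_subtractf power2_eq_square sum_distrib_right[symmetric] D(1))
  also have "\<dots> \<le> D\<^sup>2 - D\<^sup>2 / ?n"
    using sum_squared_le_sum_of_squares[of ?d UNIV] n by (simp add: D(1) divide_le_eq)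
  finally have S: "S \<le> D\<^sup>2 * x" using x(2) by (simp add: right_diff_distrib)
  have \<Delta>: "\<Delta> \<ge> 1" "\<Delta> < CARD('a)"
    using graph_diameter_pos[OF E(2) n] graph_diameter_less_card[OF E(2)] by (simp_all add: \<Delta>_def)
  \<comment> \<open>At \<open>\<Delta> = 1\<close> the truncated difference is 0 and not -1, so this
    case rests on \<open>n \<ge> 2\<close> instead.\<close>
  have "real \<Delta> + real (\<Delta> - 2) \<le> 2 * real \<Delta> * x"
  proof (cases "\<Delta> = 1")
    case True
    then show ?thesis using n by (simp add: x(2) field_simps)
  next
    case False
    then have "real (\<Delta> - 2) = real \<Delta> - 2" using \<Delta> by (simp add: of_nat_diff)
    moreover have "real \<Delta> / ?n \<le> 1" using \<Delta>(2) by simp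
    moreover have "2 * real \<Delta> * x = 2 * real \<Delta> - 2 * (real \<Delta> / ?n)"
      by (simp add: x(2) right_diff_distrib)
    ultimately show ?thesis by linarith
  qed
  then have "(real \<Delta> + real (\<Delta> - 2)) * S \<le> (2 * real \<Delta> * x) * (D\<^sup>2 * x)"
    using S S0 x(1) by (intro mult_mono) auto
  then show ?thesis
    unfolding \<Delta>_def[symmetric] D_def[symmetric] x_def[symmetric]
    by (simp add: algebra_simps power2_eq_square)
qed

subsection \<open>Concentration\<close>

lemma kemeny_constant_ge:
  fixes E :: "'a::finite set set"
  assumes E: "simple_graph E" "connected_graph E" and n: "CARD('a) \<ge> 2"
    and ne: "spanning_trees E \<noteq> {}" and m: "card E > 0"
  shows "(real CARD('a) - 1)\<^sup>2 / real CARD('a) \<le> kemeny_constant E"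
proof -
  define D where "D = 2 * real (card E)"
  have D: "D > 0" using m by (simp add: D_def)
  have "D * ((real CARD('a) - 1)\<^sup>2 / real CARD('a)) \<le> D * kemeny_constant E"
    using forest_weight_ge[OF E(1) ne m] D
    unfolding kemeny_constant_eq_forest_weight[OF E n ne, of undefined] D_def[symmetric] by simp
  then show ?thesis using D by (simp only: mult_le_cancel_left_pos)
qed

text \<open>A single vertex leaves no edges, and quotients by \<open>2 * real (card E)\<close> are 0
  by the convention for division by zero. Estimate and constant then agree.\<close>

lemma kemeny_trivial_graph:
  fixes E :: "'a::finite set set"
  assumes "simple_graph E" and "CARD('a) < 2"
  shows "card E = 0" and "kemeny_constant E = 0"
proof -
  have "E = {}"
  proof (rule equals0I)
    fix e assume "e \<in> E"
    then have "card e = 2" using assms(1) by (simp add: simple_graph_def)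
    moreover have "card e \<le> CARD('a)" by (rule card_mono) auto
    ultimately show False using assms(2) by simp
  qed
  then show "card E = 0" "kemeny_constant E = 0" by (simp_all add: kemeny_constant_def)
qed

theorem mainTheorem5:
  fixes E :: "'a::finite set set" and r :: 'a and \<tau>\<^sub>0 :: "'a set set"
    and \<epsilon> p\<^sub>f :: real and w :: nat
    and M :: "'b measure" and \<tau> :: "nat \<Rightarrow> 'b \<Rightarrow> 'a set set"
  assumes "simple_graph E" and "connected_graph E"
    and "bfs_spanning_tree E r \<tau>\<^sub>0"
    and "prob_space M"
    and "prob_space.indep_vars M (\<lambda>_. count_space UNIV) \<tau> {1..w}"
    and "\<And>i. i \<in> {1..w} \<Longrightarrow>
      distr M (count_space UNIV) (\<tau> i) = measure_pmf (pmf_of_set (spanning_trees E))"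
    and "\<epsilon> > 0" and "0 < p\<^sub>f" and "p\<^sub>f < 1"
    and "real w \<ge> 8 * (real (card E))\<^sup>2 * (real (graph_diameter E))\<^sup>2 * ln (2 / p\<^sub>f)
      / ((real CARD('a))\<^sup>2 * \<epsilon>\<^sup>2)"
  shows "measure M {x \<in> space M.
      \<bar>kemeny_estimate E r \<tau>\<^sub>0 w (\<lambda>i. \<tau> i x) - kemeny_constant E\<bar> \<le> \<epsilon> * kemeny_constant E}
    \<ge> 1 - p\<^sub>f"
proof -
  interpret prob_space M by fact
  let ?\<Delta> = "graph_diameter E" and ?T = "spanning_trees E" and ?n = "real CARD('a)"
  define D where "D = 2 * real (card E)"
  define \<kappa> where "\<kappa> = kemeny_constant E"
  define X where "X i x = tree_stat E r \<tau>\<^sub>0 (\<tau> i x)" for i x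
  have est: "kemeny_estimate E r \<tau>\<^sub>0 w (\<lambda>i. \<tau> i x) = (\<Sum>i=1..w. X i x) / (D * real w)" for x
    by (simp add: kemeny_estimate_def X_def D_def)
  show ?thesis
  proof (cases "CARD('a) \<ge> 2")
    case False
    then have "{x \<in> space M. \<bar>kemeny_estimate E r \<tau>\<^sub>0 w (\<lambda>i. \<tau> i x) - kemeny_constant E\<bar> \<le>
        \<epsilon> * kemeny_constant E} = space M"
      using kemeny_trivial_graph[OF assms(1)] by (simp add: kemeny_estimate_def)
    then show ?thesis using assms(8) by (simp add: prob_space)
  next
    case n: True
    note E = assms(1,2)
    have \<tau>0: "\<tau>\<^sub>0 \<in> ?T" using assms(3) by (simp add: bfs_spanning_tree_def)
    then have ne: "?T \<noteq> {}" by blast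
    have finT: "finite ?T" by simp
    have m: "card E > 0"
      using connected_neighbors_nonempty[OF E(2) n, of r] by (auto simp: neighbors_def card_gt_0_iff)
    then have D: "D > 0" by (simp add: D_def)
    have \<Delta>: "?\<Delta> > 0" using graph_diameter_pos[OF E(2) n] .
    \<comment> \<open>The square of \<open>q\<close> is the factor missing from
      \<open>\<kappa> \<ge> n\<close>; it reappears in the width \<open>c\<close>.\<close>
    define q where "q = (?n - 1) / ?n"
    have q: "q > 0" using n by (simp add: q_def)
    have \<kappa>_ge: "\<kappa> \<ge> ?n * q\<^sup>2"
      using kemeny_constant_ge[OF E n ne m] n
      by (simp add: \<kappa>_def q_def power2_eq_square)
    have \<kappa>_pos: "\<kappa> > 0"
    proof -
      have "?n * q\<^sup>2 > 0" using q n by simp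
      then show ?thesis using \<kappa>_ge by linarith
    qed
    define S where "S = (\<Sum>u\<in>UNIV - {r}. real (vdegree E u) * (D - real (vdegree E u)))"
    define c where "c = 2 * real ?\<Delta> * D\<^sup>2 * q\<^sup>2"
    define a where "a = - (real (?\<Delta> - 2) * S)"
    have c: "c > 0" using \<Delta> D q by (simp add: c_def)
    have range: "tree_stat E r \<tau>\<^sub>0 t \<in> {a..a + c}" if "t \<in> ?T" for t
      using tree_stat_bounds[OF E assms(3) that] tree_stat_range_le[OF E n, of r]
      unfolding D_def[symmetric] S_def[symmetric] q_def[symmetric] c_def[symmetric] a_def by auto
    have meas: "\<tau> i \<in> M \<rightarrow>\<^sub>M count_space UNIV" if "i \<in> {1..w}" for i
      using assms(5) that unfolding indep_vars_def by blast
    have bounded: "AE x in M. X i x \<in> {a..a + c}" if i: "i \<in> {1..w}" for i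
    proof -
      have "AE t in distr M (count_space UNIV) (\<tau> i). t \<in> ?T"
        unfolding assms(6)[OF i] by (simp add: AE_measure_pmf_iff set_pmf_of_set[OF ne finT])
      then have "AE x in M. \<tau> i x \<in> ?T"
        by (subst (asm) AE_distr_iff[OF meas[OF i]]) auto
      then show ?thesis using range by (auto simp: X_def)
    qed
    \<comment> \<open>Unbiasedness of one sample: the average of the statistic over all trees is the
      forest weight divided by their number.\<close>
    have mean: "expectation (X i) = D * \<kappa>" if i: "i \<in> {1..w}" for i
    proof -
      have "expectation (X i) = (\<integral>t. tree_stat E r \<tau>\<^sub>0 t \<partial>distr M (count_space UNIV) (\<tau> i))"
        unfolding X_def by (rule integral_distr[OF meas[OF i], symmetric]) simp
      also have "\<dots> = (\<Sum>t\<in>?T. tree_stat E r \<tau>\<^sub>0 t) / real (card ?T)"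
        unfolding assms(6)[OF i] by (rule integral_pmf_of_set[OF ne finT])
      also have "\<dots> = D * \<kappa>"
        using D unfolding \<kappa>_def sum_tree_stat[OF E(1) \<tau>0] kemeny_constant_eq_forest_weight[OF E n ne, of r]
        using m by (auto simp: D_def)
      finally show ?thesis .
    qed
    interpret H: Hoeffding_ineq M "{1..w}" X "\<lambda>_. a" "\<lambda>_. a + c" "\<Sum>i\<in>{1..w}. expectation (X i)"
    proof unfold_locales
      show "indep_vars (\<lambda>_. borel) X {1..w}"
        unfolding X_def by (rule indep_vars_compose2[OF assms(5)]) simp
    qed (use bounded in auto)
    have \<mu>: "(\<Sum>i\<in>{1..w}. expectation (X i)) = real w * (D * \<kappa>)"
      using mean by simp
    define L where "L = ln (2 / p\<^sub>f)"
    have L: "L > 0" using assms(8,9) by (simp add: L_def ln_gt_zero_iff)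
    \<comment> \<open>The hypothesis on \<open>w\<close> without fractions, with
      \<open>8 * m^2 = 2 * D^2\<close>.\<close>
    have w_ge: "real w * (?n\<^sup>2 * \<epsilon>\<^sup>2) \<ge> 2 * D\<^sup>2 * (real ?\<Delta>)\<^sup>2 * L"
    proof -
      have pos: "?n\<^sup>2 * \<epsilon>\<^sup>2 > 0" using assms(7) n by simp
      have "2 * D\<^sup>2 * (real ?\<Delta>)\<^sup>2 * L / (?n\<^sup>2 * \<epsilon>\<^sup>2) \<le> real w"
        using assms(10) by (simp add: D_def L_def power_mult_distrib)
      then show ?thesis using pos by (simp only: pos_divide_le_eq)
    qed
    \<comment> \<open>The required sample size is positive because \<open>p\<^sub>f < 1\<close>
      makes \<open>L\<close> positive.\<close>
    have w: "real w > 0"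
    proof (rule ccontr)
      assume "\<not> real w > 0"
      then have "2 * D\<^sup>2 * (real ?\<Delta>)\<^sup>2 * L \<le> 0" using w_ge by simp
      moreover have "2 * D\<^sup>2 * (real ?\<Delta>)\<^sup>2 * L > 0" using D \<Delta> L by simp
      ultimately show False by simp
    qed
    \<comment> \<open>The permitted error \<open>\<epsilon> * \<kappa>\<close> of the estimate,
      scaled by \<open>D * w\<close> to an error of the sum.\<close>
    define \<delta> where "\<delta> = real w * D * \<epsilon> * \<kappa>"
    have \<delta>: "\<delta> \<ge> 0" using w D \<kappa>_pos assms(7) by (simp add: \<delta>_def)
    let ?bad = "{x \<in> space M. \<bar>(\<Sum>i\<in>{1..w}. X i x) - (\<Sum>i\<in>{1..w}. expectation (X i))\<bar> \<ge> \<delta>}"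
    have sq: "(\<Sum>i\<in>{1..w}. (a + c - a)\<^sup>2) = real w * c\<^sup>2" by simp
    have "prob ?bad \<le> 2 * exp (- 2 * \<delta>\<^sup>2 / (real w * c\<^sup>2))"
      using H.Hoeffding_ineq_abs_ge[OF \<delta>] w c unfolding sq by simp
    also have "\<dots> \<le> p\<^sub>f"
    proof -
      \<comment> \<open>The factor \<open>q^4\<close> in \<open>c^2\<close> is matched by
        \<open>(n * q^2)^2 \<le> \<kappa>^2\<close>: the loss in the lower bound on
        \<open>\<kappa>\<close> and the gain in the range cancel here.\<close>
      have "L * (real w * c\<^sup>2) \<le> 2 * \<delta>\<^sup>2"
      proof -
        have "2 * D\<^sup>2 * (real ?\<Delta>)\<^sup>2 * L * (2 * real w * D\<^sup>2 * q^4) \<le>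
            real w * (?n\<^sup>2 * \<epsilon>\<^sup>2) * (2 * real w * D\<^sup>2 * q^4)"
          using w_ge by (rule mult_right_mono) simp
        moreover have "L * (real w * c\<^sup>2) = 2 * D\<^sup>2 * (real ?\<Delta>)\<^sup>2 * L * (2 * real w * D\<^sup>2 * q^4)"
          by (simp add: c_def power_mult_distrib algebra_simps power2_eq_square power4_eq_xxxx)
        moreover have "real w * (?n\<^sup>2 * \<epsilon>\<^sup>2) * (2 * real w * D\<^sup>2 * q^4) =
            2 * (real w * D * \<epsilon>)\<^sup>2 * (?n * q\<^sup>2)\<^sup>2"
          by (simp add: power_mult_distrib algebra_simps power2_eq_square power4_eq_xxxx)
        moreover have "2 * (real w * D * \<epsilon>)\<^sup>2 * (?n * q\<^sup>2)\<^sup>2 \<le> 2 * (real w * D * \<epsilon>)\<^sup>2 * \<kappa>\<^sup>2"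
          using \<kappa>_ge by (intro mult_left_mono power_mono) auto
        moreover have "2 * (real w * D * \<epsilon>)\<^sup>2 * \<kappa>\<^sup>2 = 2 * \<delta>\<^sup>2"
          by (simp add: \<delta>_def power_mult_distrib)
        ultimately show ?thesis by linarith
      qed
      then have "L \<le> 2 * \<delta>\<^sup>2 / (real w * c\<^sup>2)"
        using w c by (simp add: pos_le_divide_eq)
      then have "exp (- 2 * \<delta>\<^sup>2 / (real w * c\<^sup>2)) \<le> exp (- L)" by simp
      \<comment> \<open>The 2 inside the logarithm absorbs the factor 2 of the two-sided Hoeffding
        bound.\<close>
      also have "exp (- L) = p\<^sub>f / 2" using assms(8) by (simp add: L_def exp_minus)
      finally show ?thesis by simp
    qed
    finally have bad: "prob ?bad \<le> p\<^sub>f" .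
    have [measurable]: "X i \<in> borel_measurable M" if "i \<in> {1..w}" for i
      using H.random_variable[OF that] .
    have bad_meas: "?bad \<in> events" by measurable
    have "1 - p\<^sub>f \<le> prob (space M - ?bad)" using prob_compl[OF bad_meas] bad by simp
    also have "\<dots> \<le> prob {x \<in> space M. \<bar>(\<Sum>i=1..w. X i x) / (D * real w) - \<kappa>\<bar> \<le> \<epsilon> * \<kappa>}"
    proof (rule finite_measure_mono)
      show "{x \<in> space M. \<bar>(\<Sum>i=1..w. X i x) / (D * real w) - \<kappa>\<bar> \<le> \<epsilon> * \<kappa>} \<in> events" by measurable
      show "space M - ?bad \<subseteq> {x \<in> space M. \<bar>(\<Sum>i=1..w. X i x) / (D * real w) - \<kappa>\<bar> \<le> \<epsilon> * \<kappa>}"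
      proof
        fix x assume x: "x \<in> space M - ?bad"
        have Dw: "D * real w > 0" using D w by simp
        have "(\<Sum>i=1..w. X i x) / (D * real w) - \<kappa> = ((\<Sum>i=1..w. X i x) - real w * (D * \<kappa>)) / (D * real w)"
          using D w by (simp add: diff_divide_distrib)
        then have "\<bar>(\<Sum>i=1..w. X i x) / (D * real w) - \<kappa>\<bar> =
            \<bar>(\<Sum>i=1..w. X i x) - real w * (D * \<kappa>)\<bar> / (D * real w)"
          using Dw by (simp only: abs_divide abs_of_pos)
        also have "\<dots> \<le> \<delta> / (D * real w)"
          using x Dw unfolding \<mu> by (intro divide_right_mono) auto
        also have "\<dots> = \<epsilon> * \<kappa>" using D w by (simp add: \<delta>_def)
        finally show "x \<in> {x \<in> space M. \<bar>(\<Sum>i=1..w. X i x) / (D * real w) - \<kappa>\<bar> \<le> \<epsilon> * \<kappa>}"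
          using x by simp
      qed
    qed
    finally show ?thesis unfolding est \<kappa>_def .
  qed
qed

end
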